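(* Let $p>q\ge 2$, let $V(x)=\frac{|x|^p}{p}-\frac{|x|^q}{q}$ on ${\mathbb R}$, let $E(\rho)=\frac12\iint V(x-y)\,d\rho(x)\,d\rho(y)$ for $\rho\in\mathcal P({\mathbb R})$, and for $0<m<1$ let $\rho_m^*=m\delta_0+(1-m)\delta_1$. Then: (1) If $p>q>2$, then for every $m\in(0,1)$, $\rho_m^*$ is a $d_\infty$-strict local minimizer. (2) If $p>3$, $q=2$, then for every $m\in(\frac{1}{p-1},\frac{p-2}{p-1})$, $\rho_m^*$ is a $d_\infty$-strict local minimizer. (3) If $p>3$, $q=2$, then for every $m\in(0,\frac{1}{p-1}]\cup[\frac{p-2}{p-1},1)$, $\rho_m^*$ is a $d_\infty$-saddle point. (4) If $3>p>q=2$, then for every $m\in(0,1)$, $\rho_m^*$ is a $d_\infty$-saddle point. (5) If $p=3$, $q=2$, then for every $m\in(0,\frac12)\cup(\frac12,1)$, $\rho_m^*$ is a $d_\infty$-saddle point. (6) If $p=3$, $q=2$, then $\rho_{1/2}^*$ is a $d_\infty$-strict local minimizer.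
   Context: $\mathcal P({\mathbb R})$ denotes the Borel probability measures on ${\mathbb R}$. The $\infty$-Wasserstein distance is $d_\infty(\mu,\nu)=\inf_{\pi\in\Pi(\mu,\nu)}\sup_{(x,y)\in\operatorname{supp}\pi}|x-y|$, where $\Pi(\mu,\nu)$ is the set of couplings of $\mu,\nu$. A measure $\rho$ is a steady state if $(V'*\rho)(x)=\int V'(x-y)\,d\rho(y)=0$ for all $x\in\operatorname{supp}\rho$ (each $\rho_m^*$ is a steady state). For a steady state $\rho$: $\rho$ is a $d_\infty$-strict local minimizer if there is $\epsilon>0$ such that for all $\rho'\in\mathcal P({\mathbb R})$ with $d_\infty(\rho,\rho')<\epsilon$ one has $E(\rho)\le E(\rho')$, with equality if and only if $\rho'$ is a translation of $\rho$; $\rho$ is a $d_\infty$-saddle point if for every $\epsilon>0$, $\rho$ is neither a minimizer nor a maximizer of $E$ on the ball $\{\mu: d_\infty(\mu,\rho)<\epsilon\}$. *)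

theory Defs
  imports "HOL-Probability.Probability"
begin

definition prob_meas :: "real measure \<Rightarrow> bool" where
  "prob_meas \<mu> \<longleftrightarrow> prob_space \<mu> \<and> sets \<mu> = sets (borel :: real measure)"

definition couplings :: "real measure \<Rightarrow> real measure \<Rightarrow> (real \<times> real) measure set" where
  "couplings \<mu> \<nu> = {\<pi>. prob_space \<pi> \<and> sets \<pi> = sets (borel :: (real \<times> real) measure)
      \<and> distr \<pi> borel fst = \<mu> \<and> distr \<pi> borel snd = \<nu>}"

definition supp2 :: "(real \<times> real) measure \<Rightarrow> (real \<times> real) set" where
  "supp2 \<pi> = {z. \<forall>e>0. emeasure \<pi> (ball z e) > 0}"

definition d_inf :: "real measure \<Rightarrow> real measure \<Rightarrow> ereal" where
  "d_inf \<mu> \<nu> = (INF \<pi>\<in>couplings \<mu> \<nu>. SUP z\<in>supp2 \<pi>. ereal \<bar>fst z - snd z\<bar>)"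

definition V :: "real \<Rightarrow> real \<Rightarrow> real \<Rightarrow> real" where
  "V p q x = \<bar>x\<bar> powr p / p - \<bar>x\<bar> powr q / q"

definition energy :: "real \<Rightarrow> real \<Rightarrow> real measure \<Rightarrow> real" where
  "energy p q \<rho> = 1/2 * (\<integral>x. (\<integral>y. V p q (x - y) \<partial>\<rho>) \<partial>\<rho>)"

definition translate :: "real \<Rightarrow> real measure \<Rightarrow> real measure" where
  "translate c \<rho> = distr \<rho> borel (\<lambda>x. x + c)"

definition rho_star :: "real \<Rightarrow> real measure" where
  "rho_star m = measure_of UNIV (sets borel)
     (\<lambda>A. ennreal m * indicator A 0 + ennreal (1 - m) * indicator A 1)"

definition strict_local_min :: "real \<Rightarrow> real \<Rightarrow> real measure \<Rightarrow> bool" where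
  "strict_local_min p q \<rho> \<longleftrightarrow> (\<exists>\<epsilon>>0. \<forall>\<rho>'. prob_meas \<rho>' \<and> d_inf \<rho> \<rho>' < ereal \<epsilon> \<longrightarrow>
      energy p q \<rho> \<le> energy p q \<rho>' \<and>
      (energy p q \<rho> = energy p q \<rho>' \<longleftrightarrow> (\<exists>c. \<rho>' = translate c \<rho>)))"

definition saddle_point :: "real \<Rightarrow> real \<Rightarrow> real measure \<Rightarrow> bool" where
  "saddle_point p q \<rho> \<longleftrightarrow> (\<forall>\<epsilon>>0.
      \<not> (\<forall>\<mu>. prob_meas \<mu> \<and> d_inf \<rho> \<mu> < ereal \<epsilon> \<longrightarrow> energy p q \<rho> \<le> energy p q \<mu>) \<and>
      \<not> (\<forall>\<mu>. prob_meas \<mu> \<and> d_inf \<rho> \<mu> < ereal \<epsilon> \<longrightarrow> energy p q \<mu> \<le> energy p q \<rho>))"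

end

theory Submission
  imports Defs "HOL-Real_Asymp.Real_Asymp"
begin

text \<open>
  If \<open>\<rho>'\<close> is close to \<open>\<rho>\<^sub>m\<^sup>*\<close>, a coupling with small displacement forces
  \<open>\<rho>' = m N\<^sub>0 + (1 - m) (1 + N\<^sub>1)\<close> for probability measures \<open>N\<^sub>0\<close>, \<open>N\<^sub>1\<close> concentrated near 0,
  and the energy difference splits into self-interactions of \<open>N\<^sub>0\<close> and \<open>N\<^sub>1\<close> and their cross interaction.
  The convexity of \<open>V\<close> at 1 makes the cross interaction gain a multiple of
  \<open>Var N\<^sub>0 + Var N\<^sub>1 + (mean N\<^sub>1 - mean N\<^sub>0)\<^sup>2\<close>, while a self-interaction loses at most a small multiple
  of the variance for \<open>q > 2\<close>, and half of it for \<open>q = 2\<close>. Comparing coefficients yields the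
  strict minima (1) and (2). For the saddles, the mass \<open>m\<close> at one atom is split into
  \<open>m / 3\<close> displaced by \<open>2 h\<close> towards the other atom and \<open>2 m / 3\<close> displaced by \<open>- h\<close>: at the critical
  mass the second-order terms cancel and, as the third derivative of \<open>V\<close> at 1 is positive, the third moment lowers the energy.

  In the case \<open>p = 3\<close>, \<open>q = 2\<close>, \<open>m = 1/2\<close> the variances cancel exactly and the third moments of the cross
  term compete with the cubic self-interaction. There one needs
  \<open>\<integral>\<integral> |x - y|\<^sup>3 \<ge> 2 |\<integral> x\<^sup>3| + (Var)\<^sup>2 / R\<close> for centred measures on \<open>[- R, R]\<close>, which follows by
  integrating the pointwise bound \<open>cubic_kernel_lower_bound\<close>.
\<close>

subsection \<open>Couplings and atomic measures\<close>

text \<open>The complement of the support is a union of null balls. The Lindelof property reduces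
  this union to a countable one, which is again null.\<close>

lemma AE_in_supp2:
  fixes \<pi> :: "(real \<times> real) measure"
  assumes sets: "sets \<pi> = sets borel"
  shows "AE z in \<pi>. z \<in> supp2 \<pi>"
proof -
  define F where "F = {ball z e | z e. e > 0 \<and> emeasure \<pi> (ball z e) = 0}"
  have "\<And>S. S \<in> F \<Longrightarrow> open S" unfolding F_def by auto
  then obtain F' where F': "F' \<subseteq> F" "countable F'" "\<Union>F' = \<Union>F"
    by (rule Lindelof)
  have "\<Union>F' \<in> null_sets \<pi>"
  proof (rule null_sets_UN'[where N="\<lambda>S. S" and I=F', simplified])
    show "countable F'" by fact
    fix S assume "S \<in> F'"
    then show "S \<in> null_sets \<pi>"
      using F' sets by (auto simp: F_def null_sets_def subset_eq)
  qed
  then have "AE z in \<pi>. z \<notin> \<Union>F"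
    unfolding F' by (rule AE_not_in)
  then show ?thesis
  proof eventually_elim
    case (elim z)
    show ?case unfolding supp2_def
    proof safe
      fix e :: real assume "e > 0"
      with elim have "emeasure \<pi> (ball z e) \<noteq> 0"
        unfolding F_def by (metis (mono_tags, lifting) UnionI centre_in_ball mem_Collect_eq)
      then show "0 < emeasure \<pi> (ball z e)" by (simp add: zero_less_iff_neq_zero)
    qed
  qed
qed

text \<open>A point outside \<open>C\<close> has a ball disjoint from \<open>C\<close>, and that
  ball is null. This bounds the supremum in \<open>d_inf\<close> from above once an almost sure
  displacement bound is known.\<close>

lemma supp2_subset_closed:
  assumes "closed C" and sets: "sets \<pi> = sets borel" and ae: "AE z in \<pi>. z \<in> C"
  shows "supp2 \<pi> \<subseteq> C"
proof
  fix z assume z: "z \<in> supp2 \<pi>"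
  show "z \<in> C"
  proof (rule ccontr)
    assume "z \<notin> C"
    then obtain e where e: "e > 0" "ball z e \<subseteq> - C"
      using \<open>closed C\<close> by (metis ComplI open_contains_ball closed_def)
    have "AE x in \<pi>. x \<notin> ball z e" using ae by eventually_elim (use e in auto)
    then have "emeasure \<pi> (ball z e) = 0"
      by (subst (asm) AE_iff_measurable[OF _ refl]) (auto simp: sets sets_eq_imp_space_eq[OF sets] ball_def)
    with z e(1) show False by (auto simp: supp2_def)
  qed
qed

text \<open>The strict inequality selects one coupling whose supremum over the support is below
  \<epsilon>. Since almost every point lies in the support, that supremum controls the displacement
  almost surely.\<close>

lemma d_inf_less_imp_coupling:
  assumes "d_inf \<mu> \<nu> < ereal \<epsilon>"
  obtains \<pi> where "\<pi> \<in> couplings \<mu> \<nu>" "AE z in \<pi>. \<bar>fst z - snd z\<bar> < \<epsilon>"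
proof -
  from assms obtain \<pi> where \<pi>: "\<pi> \<in> couplings \<mu> \<nu>"
    and lt: "(SUP z\<in>supp2 \<pi>. ereal \<bar>fst z - snd z\<bar>) < ereal \<epsilon>"
    unfolding d_inf_def INF_less_iff by blast
  have "AE z in \<pi>. z \<in> supp2 \<pi>"
    using \<pi> by (intro AE_in_supp2) (simp add: couplings_def)
  then have "AE z in \<pi>. \<bar>fst z - snd z\<bar> < \<epsilon>"
  proof eventually_elim
    case (elim z)
    then have "ereal \<bar>fst z - snd z\<bar> \<le> (SUP z\<in>supp2 \<pi>. ereal \<bar>fst z - snd z\<bar>)"
      by (intro SUP_upper)
    from this lt have "ereal \<bar>fst z - snd z\<bar> < ereal \<epsilon>" by (rule le_less_trans)
    then show ?case by simp
  qed
  with \<pi> show ?thesis by (rule that)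
qed

text \<open>Atoms are labelled by an index set instead of by their positions. Two labels may share a
  position, so an atom can be divided without changing the measure, and moving atoms changes only
  \<open>f\<close>.\<close>

definition atoms :: "nat set \<Rightarrow> (nat \<Rightarrow> real) \<Rightarrow> (nat \<Rightarrow> real) \<Rightarrow> real measure" where
  "atoms I w f = distr (point_measure I (\<lambda>i. ennreal (w i))) borel f"

lemma sets_atoms [simp, measurable_cong]: "sets (atoms I w f) = sets borel"
  and space_atoms [simp]: "space (atoms I w f) = UNIV"
  by (simp_all add: atoms_def)

lemma prob_space_weights:
  assumes "finite I" "\<And>i. i \<in> I \<Longrightarrow> 0 \<le> w i" "sum w I = 1"
  shows "prob_space (point_measure I (\<lambda>i. ennreal (w i)))"
  using assms by (intro prob_space_point_measure) auto

lemma emeasure_atoms: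
  assumes "finite I" "A \<in> sets borel"
  shows "emeasure (atoms I w f) A = (\<Sum>i\<in>I. ennreal (w i) * indicator A (f i))"
proof -
  have "emeasure (atoms I w f) A
      = emeasure (point_measure I (\<lambda>i. ennreal (w i))) (f -` A \<inter> I)"
    using assms by (simp add: atoms_def emeasure_distr space_point_measure)
  also have "\<dots> = (\<Sum>i\<in>f -` A \<inter> I. ennreal (w i))"
    using assms by (subst emeasure_point_measure_finite) auto
  also have "\<dots> = (\<Sum>i\<in>I. ennreal (w i) * indicator A (f i))"
    using assms by (intro sum.mono_neutral_cong_left) (auto simp: indicator_def)
  finally show ?thesis .
qed

lemma integral_atoms:
  fixes g :: "real \<Rightarrow> real"
  assumes "finite I" "\<And>i. i \<in> I \<Longrightarrow> 0 \<le> w i" and [measurable]: "g \<in> borel_measurable borel"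
  shows "(\<integral>x. g x \<partial>atoms I w f) = (\<Sum>i\<in>I. w i * g (f i))"
proof -
  have "(\<integral>x. g x \<partial>atoms I w f) = (\<integral>i. g (f i) \<partial>point_measure I (\<lambda>i. ennreal (w i)))"
    unfolding atoms_def by (rule integral_distr) (auto simp: measurable_point_measure_eq1)
  also have "\<dots> = (\<Sum>i\<in>I. w i * g (f i))"
    using assms by (subst lebesgue_integral_point_measure_finite) auto
  finally show ?thesis .
qed

lemma prob_meas_atoms:
  assumes "finite I" "\<And>i. i \<in> I \<Longrightarrow> 0 \<le> w i" "sum w I = 1"
  shows "prob_meas (atoms I w f)"
  unfolding prob_meas_def atoms_def
  by (auto intro!: prob_space.prob_space_distr prob_space_weights assms)

text \<open>Pushing the weights forward along \<open>i\<close> \<mapsto> \<open>(f i, g i)\<close>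
  transports every label from its old to its new position, so this coupling displaces mass by at
  most \<open>h\<close>.\<close>

lemma d_inf_atoms_le:
  assumes I: "finite I" "\<And>i. i \<in> I \<Longrightarrow> 0 \<le> w i" "sum w I = 1"
    and h: "\<And>i. i \<in> I \<Longrightarrow> \<bar>f i - g i\<bar> \<le> h"
  shows "d_inf (atoms I w f) (atoms I w g) \<le> ereal h"
proof -
  let ?P = "point_measure I (\<lambda>i. ennreal (w i))"
  define \<pi> where "\<pi> = distr ?P (borel :: (real \<times> real) measure) (\<lambda>i. (f i, g i))"
  interpret prob_space ?P by (rule prob_space_weights) fact+
  have sets: "sets \<pi> = sets borel" by (simp add: \<pi>_def)
  have [measurable]: "fst \<in> borel_measurable (borel :: (real \<times> real) measure)"
      "snd \<in> borel_measurable (borel :: (real \<times> real) measure)"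
    by (auto intro!: borel_measurable_continuous_onI continuous_intros)
  have "\<pi> \<in> couplings (atoms I w f) (atoms I w g)"
    unfolding couplings_def \<pi>_def atoms_def
    by (auto intro!: prob_space_distr simp: distr_distr o_def measurable_point_measure_eq1)
  moreover have "AE z in \<pi>. z \<in> {z. \<bar>fst z - snd z\<bar> \<le> h}"
    unfolding \<pi>_def using h I
    by (subst AE_distr_iff) (auto simp: AE_point_measure)
  then have "supp2 \<pi> \<subseteq> {z. \<bar>fst z - snd z\<bar> \<le> h}"
    by (intro supp2_subset_closed sets closed_Collect_le continuous_intros) 
  then have "(SUP z\<in>supp2 \<pi>. ereal \<bar>fst z - snd z\<bar>) \<le> ereal h"
    by (intro SUP_least) auto
  ultimately show ?thesis unfolding d_inf_def by (rule INF_lower2)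
qed

section \<open>The potential, and energies of atomic measures\<close>

lemma continuous_V:
  assumes "p > 0" "q > 0" shows "continuous_on UNIV (V p q)"
  unfolding V_def using assms by (intro continuous_intros continuous_on_powr') auto

lemma V_measurable [measurable]: "V p q \<in> borel_measurable borel"
  unfolding V_def by measurable

lemma V_0 [simp]: "V p q 0 = 0"
  by (simp add: V_def)

lemma V_minus: "V p q (- x) = V p q x"
  by (simp add: V_def)

lemma energy_atoms:
  assumes "finite I" "\<And>i. i \<in> I \<Longrightarrow> 0 \<le> w i"
  shows "energy p q (atoms I w f) = 1/2 * (\<Sum>i\<in>I. \<Sum>j\<in>I. w i * w j * V p q (f i - f j))"
  unfolding energy_def
  by (simp add: integral_atoms[OF assms] sum_distrib_left mult.assoc)

text \<open>\<open>measure_of\<close> takes over the given set function only when that function is a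
  measure. Agreement with an existing measure \<open>M\<close> on the Borel sets settles this
  without a separate proof of countable additivity.\<close>

lemma emeasure_rho_star_eq:
  assumes "\<And>A. A \<in> sets borel \<Longrightarrow>
      emeasure M A = ennreal m * indicator A 0 + ennreal (1 - m) * indicator A 1"
    and sets: "sets M = sets borel"
  shows "rho_star m = M"
proof -
  have "rho_star m = measure_of (space M) (sets M) (emeasure M)"
    unfolding rho_star_def sets sets_eq_imp_space_eq[OF sets] space_borel
    by (rule measure_of_eq) (auto simp: assms sets.sigma_sets_eq[of borel, simplified])
  then show ?thesis by (simp add: measure_of_of_measure)
qed


lemma rho_star_eq_atoms:
  assumes "0 < m" "m < 1" "i \<noteq> j"
  shows "rho_star m = atoms {i, j} (\<lambda>k. if k = i then m else 1 - m) (\<lambda>k. if k = i then 0 else 1)"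
proof (rule emeasure_rho_star_eq)
  fix A :: "real set" assume "A \<in> sets borel"
  then show "emeasure (atoms {i, j} (\<lambda>k. if k = i then m else 1 - m) (\<lambda>k. if k = i then 0 else 1)) A
      = ennreal m * indicator A 0 + ennreal (1 - m) * indicator A 1"
    using assms(3) by (subst emeasure_atoms) (auto simp del: sum_mult_indicator)
qed simp

lemma emeasure_rho_star:
  assumes "0 < m" "m < 1" "A \<in> sets borel"
  shows "emeasure (rho_star m) A = ennreal m * indicator A 0 + ennreal (1 - m) * indicator A 1"
  using assms(3) by (subst rho_star_eq_atoms[OF assms(1,2), of 0 1], simp, subst emeasure_atoms)
    (auto simp del: sum_mult_indicator)

lemma sets_rho_star [simp]: "sets (rho_star m) = sets borel"
  unfolding rho_star_def using sets.sigma_sets_eq[of "borel :: real measure"] by simp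

lemma energy_rho_star:
  assumes "0 < m" "m < 1"
  shows "energy p q (rho_star m) = m * (1 - m) * V p q 1"
proof -
  have "V p q (-1) = V p q 1" by (rule V_minus)
  then show ?thesis
    by (subst rho_star_eq_atoms[OF assms, of 0 1]) (use assms in \<open>auto simp: energy_atoms\<close>)
qed

subsection \<open>Measures near a two-atom steady state\<close>

definition concentrated :: "real \<Rightarrow> real measure \<Rightarrow> bool" where
  "concentrated R N \<longleftrightarrow> prob_space N \<and> sets N = sets borel \<and> (AE x in N. \<bar>x\<bar> \<le> R)"

lemma integral_uniform_measure:
  fixes F :: "real \<Rightarrow> real"
  assumes [measurable]: "A \<in> sets M" "F \<in> borel_measurable M"
    and m: "emeasure M A = ennreal m" "m > 0"
  shows "(\<integral>x. F x \<partial>uniform_measure M A) = (\<integral>x. indicator A x * F x \<partial>M) / m"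
proof -
  have "uniform_measure M A = density M (\<lambda>x. ennreal (indicator A x / m))"
    unfolding uniform_measure_def m(1)
    by (rule density_cong) (auto simp: divide_ennreal m(2) simp flip: ennreal_indicator)
  then show ?thesis
    using m by (simp add: integral_density)
qed

text \<open>Under a coupling with displacement below \<epsilon> the first coordinate is almost
  surely 0 or 1. As \<epsilon> \<le> 1/2, the second coordinate is below 1/2 exactly when its mass
  came from the atom at 0, so no mass is exchanged between the two clusters.\<close>

lemma d_inf_rho_star_less_imp:
  assumes m: "0 < m" "m < 1" and \<epsilon>: "\<epsilon> \<le> 1/2"
    and M: "prob_meas M" and d: "d_inf (rho_star m) M < ereal \<epsilon>"
  shows "AE x in M. \<bar>x\<bar> < \<epsilon> \<or> \<bar>x - 1\<bar> < \<epsilon>" "emeasure M {..<1/2} = ennreal m"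
proof -
  obtain \<pi> where \<pi>: "\<pi> \<in> couplings (rho_star m) M" and ae: "AE z in \<pi>. \<bar>fst z - snd z\<bar> < \<epsilon>"
    using d by (rule d_inf_less_imp_coupling)
  from \<pi> have sets[measurable_cong]: "sets \<pi> = sets borel"
    and 1: "distr \<pi> borel fst = rho_star m" and 2: "distr \<pi> borel snd = M"
    by (auto simp: couplings_def)
  have [measurable]: "fst \<in> borel_measurable (borel :: (real \<times> real) measure)"
      "snd \<in> borel_measurable (borel :: (real \<times> real) measure)"
    by (auto intro!: borel_measurable_continuous_onI continuous_intros)
  have sp: "space \<pi> = UNIV" using sets_eq_imp_space_eq[OF sets] by simp
  have "emeasure (rho_star m) (- {0, 1}) = 0"
    using m by (subst emeasure_rho_star) simp_all
  then have "AE x in distr \<pi> borel fst. x \<in> {0, 1}"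
    unfolding 1 by (intro AE_I'[where N="- {0, 1}"]) (auto simp: null_sets_def)
  then have "AE z in \<pi>. fst z \<in> {0, 1}"
    by (rule AE_distrD[rotated]) measurable
  with ae have ae': "AE z in \<pi>. \<bar>fst z - snd z\<bar> < \<epsilon> \<and> fst z \<in> {0, 1}" by auto
  show "AE x in M. \<bar>x\<bar> < \<epsilon> \<or> \<bar>x - 1\<bar> < \<epsilon>"
  proof (subst 2[symmetric], subst AE_distr_iff)
    show "AE z in \<pi>. \<bar>snd z\<bar> < \<epsilon> \<or> \<bar>snd z - 1\<bar> < \<epsilon>"
      using ae' by eventually_elim auto
  qed auto
  have "emeasure M {..<1/2} = emeasure \<pi> (snd -` {..<1/2} \<inter> space \<pi>)"
    unfolding 2[symmetric] by (rule emeasure_distr) auto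
  also have "\<dots> = emeasure \<pi> (fst -` {0} \<inter> space \<pi>)"
  proof (rule emeasure_eq_AE)
    show "AE z in \<pi>. z \<in> snd -` {..<1/2} \<inter> space \<pi> \<longleftrightarrow> z \<in> fst -` {0} \<inter> space \<pi>"
      using ae' by eventually_elim (use \<epsilon> in \<open>auto simp: sp\<close>)
  qed auto
  also have "\<dots> = emeasure (rho_star m) {0}"
    unfolding 1[symmetric] by (rule emeasure_distr[symmetric]) auto
  also have "\<dots> = ennreal m" using m by (simp add: emeasure_rho_star)
  finally show "emeasure M {..<1/2} = ennreal m" .
qed

text \<open>\<open>N0\<close> is \<open>M\<close> conditioned on the half-line left of 1/2, and
  \<open>N1\<close> is \<open>M\<close> conditioned on the other half-line and shifted back by 1.
  The decomposition is phrased through integrals because it is applied to each variable of the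
  energy in turn.\<close>

lemma split_near_rho_star:
  assumes m: "0 < m" "m < 1" and \<epsilon>: "\<epsilon> \<le> 1/2"
    and M: "prob_meas M" and d: "d_inf (rho_star m) M < ereal \<epsilon>"
  obtains N0 N1 where "concentrated \<epsilon> N0" "concentrated \<epsilon> N1"
    "\<And>F :: real \<Rightarrow> real. integrable M F \<Longrightarrow>
      (\<integral>x. F x \<partial>M) = m * (\<integral>x. F x \<partial>N0) + (1 - m) * (\<integral>y. F (1 + y) \<partial>N1)"
proof -
  define A where "A = {..<1/2 :: real}"
  define B where "B = {1/2 :: real..}"
  note near = d_inf_rho_star_less_imp[OF m \<epsilon> M d]
  interpret prob_space M using M by (simp add: prob_meas_def)
  have sets[measurable_cong, simp]: "sets M = sets borel" using M by (simp add: prob_meas_def)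
  have sp: "space M = UNIV" using sets_eq_imp_space_eq[OF sets] by simp
  have A: "emeasure M A = ennreal m" using near(2) by (simp add: A_def)
  have "prob A = m" using A m by (simp add: emeasure_eq_measure)
  moreover have "B = space M - A" by (auto simp: A_def B_def sp)
  ultimately have B: "emeasure M B = ennreal (1 - m)"
    using prob_compl[of A] by (simp add: emeasure_eq_measure A_def)
  define N0 where "N0 = uniform_measure M A"
  define N1 where "N1 = distr (uniform_measure M B) borel (\<lambda>x. x - 1)"
  have P0: "prob_space N0" unfolding N0_def
    by (rule prob_space_uniform_measure) (use A m in auto)
  have PB: "prob_space (uniform_measure M B)"
    by (rule prob_space_uniform_measure) (use B m in auto)
  have P1: "prob_space N1" unfolding N1_def
    by (rule prob_space.prob_space_distr[OF PB]) simp
  have "AE x in M. x \<in> A \<longrightarrow> \<bar>x\<bar> \<le> \<epsilon>"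
    using near(1) by eventually_elim (use \<epsilon> in \<open>auto simp: A_def\<close>)
  then have "AE x in N0. \<bar>x\<bar> \<le> \<epsilon>"
    unfolding N0_def by (intro AE_uniform_measureI) (auto simp: A_def)
  moreover have "sets N0 = sets borel" by (simp add: N0_def)
  ultimately have c0: "concentrated \<epsilon> N0" using P0 by (simp add: concentrated_def)
  have "AE x in M. x \<in> B \<longrightarrow> \<bar>x - 1\<bar> \<le> \<epsilon>"
    using near(1) by eventually_elim (use \<epsilon> in \<open>auto simp: B_def\<close>)
  then have "AE x in uniform_measure M B. \<bar>x - 1\<bar> \<le> \<epsilon>"
    by (intro AE_uniform_measureI) (auto simp: B_def)
  then have "AE x in N1. \<bar>x\<bar> \<le> \<epsilon>"
    unfolding N1_def by (subst AE_distr_iff) auto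
  moreover have "sets N1 = sets borel" by (simp add: N1_def)
  ultimately have c1: "concentrated \<epsilon> N1" using P1 by (simp add: concentrated_def)
  have "(\<integral>x. F x \<partial>M) = m * (\<integral>x. F x \<partial>N0) + (1 - m) * (\<integral>y. F (1 + y) \<partial>N1)"
    if F: "integrable M F" for F :: "real \<Rightarrow> real"
  proof -
    from F have [measurable]: "F \<in> borel_measurable M" by auto
    have Fb [measurable]: "F \<in> borel_measurable borel" by measurable
    have i: "integrable M (\<lambda>x. indicator A x * F x)" "integrable M (\<lambda>x. indicator B x * F x)"
      using integrable_mult_indicator[of A M F] integrable_mult_indicator[of B M F] F
      by (simp_all add: A_def B_def)
    have "(\<integral>x. F x \<partial>M) = (\<integral>x. indicator A x * F x + indicator B x * F x \<partial>M)"
      by (rule Bochner_Integration.integral_cong) (simp_all add: A_def B_def split: split_indicator)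
    also have "\<dots> = (\<integral>x. indicator A x * F x \<partial>M) + (\<integral>x. indicator B x * F x \<partial>M)"
      using i by (rule Bochner_Integration.integral_add)
    also have "(\<integral>x. indicator A x * F x \<partial>M) = m * (\<integral>x. F x \<partial>N0)"
      unfolding N0_def using m by (subst integral_uniform_measure[OF _ _ A m(1)]) (simp_all add: A_def)
    also have "(\<integral>x. indicator B x * F x \<partial>M) = (1 - m) * (\<integral>x. F x \<partial>uniform_measure M B)"
      using m by (subst integral_uniform_measure[OF _ _ B]) (simp_all add: B_def)
    also have "(\<integral>x. F x \<partial>uniform_measure M B) = (\<integral>y. F (1 + y) \<partial>N1)"
      unfolding N1_def by (subst integral_distr) (use Fb in simp_all)
    finally show ?thesis .
  qed
  with c0 c1 show ?thesis by (rule that)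
qed

section \<open>Integrability and iterated integrals for measures of bounded support\<close>

lemma concentrated_integrable:
  fixes F :: "real \<Rightarrow> real"
  assumes N: "concentrated R N" and F: "F \<in> borel_measurable borel"
    and B: "\<And>x. \<bar>x\<bar> \<le> R \<Longrightarrow> \<bar>F x\<bar> \<le> B"
  shows "integrable N F"
proof -
  interpret prob_space N using N by (simp add: concentrated_def)
  have "F \<in> borel_measurable N" using F N measurable_cong_sets[of N borel borel borel]
    by (auto simp: concentrated_def)
  then show ?thesis
    by (intro integrable_const_bound[where B=B])
      (use N B in \<open>auto simp: concentrated_def elim!: eventually_mono\<close>)
qed

lemma continuous_bounded_box:
  fixes G :: "real \<Rightarrow> real \<Rightarrow> real"
  assumes "continuous_on UNIV (\<lambda>z. G (fst z) (snd z))"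
  obtains B where "\<And>x y. \<bar>x\<bar> \<le> R \<Longrightarrow> \<bar>y\<bar> \<le> S \<Longrightarrow> \<bar>G x y\<bar> \<le> B"
proof -
  have "compact ((\<lambda>z. G (fst z) (snd z)) ` ({-R..R} \<times> {-S..S}))"
    by (intro compact_continuous_image continuous_on_subset[OF assms] compact_Times) auto
  then obtain B where B: "\<And>z. z \<in> {-R..R} \<times> {-S..S} \<Longrightarrow> norm (G (fst z) (snd z)) \<le> B"
    unfolding bounded_iff by (metis (mono_tags, lifting) bounded_iff compact_imp_bounded imageI)
  show ?thesis
  proof (rule that[of B])
    fix x y assume "\<bar>x\<bar> \<le> R" "\<bar>y\<bar> \<le> S"
    then show "\<bar>G x y\<bar> \<le> B" using B[of "(x, y)"] by (auto simp: abs_le_iff)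
  qed
qed

lemma concentrated_integrable_continuous:
  assumes "concentrated R N" "continuous_on UNIV (F :: real \<Rightarrow> real)"
  shows "integrable N F"
proof -
  have "continuous_on UNIV (\<lambda>z :: real \<times> real. F (fst z))"
    by (rule continuous_on_compose2[OF assms(2)]) (auto intro!: continuous_intros)
  then obtain B where "\<And>x y. \<bar>x\<bar> \<le> R \<Longrightarrow> \<bar>y\<bar> \<le> (0::real) \<Longrightarrow> \<bar>F x\<bar> \<le> B"
    by (rule continuous_bounded_box[of "\<lambda>x y. F x"]) blast
  then show ?thesis
    by (intro concentrated_integrable[OF assms(1), of _ B] borel_measurable_continuous_onI assms) force
qed

text \<open>Continuity bounds \<open>G\<close> on the compact box that carries both measures. The
  inner integral inherits this bound and is measurable in the outer variable, hence
  integrable.\<close>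

lemma concentrated_double_integrable:
  assumes N: "concentrated R N" "concentrated S N'"
    and G: "continuous_on UNIV (\<lambda>z. G (fst z) (snd z) :: real)"
  shows "integrable N' (G x)" "integrable N (\<lambda>x. \<integral>y. G x y \<partial>N')"
proof -
  interpret N': prob_space N' using N by (simp add: concentrated_def)
  have i: "integrable N' (G x)" for x
    by (intro concentrated_integrable_continuous[OF N(2)] continuous_on_compose2[OF G, of _ "\<lambda>y. (x, y)", simplified])
      (auto intro!: continuous_intros)
  then show "integrable N' (G x)" .
  obtain B where B: "\<And>x y. \<bar>x\<bar> \<le> R \<Longrightarrow> \<bar>y\<bar> \<le> S \<Longrightarrow> \<bar>G x y\<bar> \<le> B"
    using continuous_bounded_box[OF G] by metis
  have [measurable_cong]: "sets N' = sets borel" using N by (simp add: concentrated_def)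
  have "(\<lambda>z. G (fst z) (snd z)) \<in> borel_measurable (borel \<Otimes>\<^sub>M borel)"
    unfolding borel_prod by (rule borel_measurable_continuous_onI[OF G])
  then have "(\<lambda>z. G (fst z) (snd z)) \<in> borel_measurable (borel \<Otimes>\<^sub>M N')"
    by measurable
  then have "(\<lambda>x. \<integral>y. G x y \<partial>N') \<in> borel_measurable borel"
    by (intro N'.borel_measurable_lebesgue_integral) (simp add: case_prod_beta')
  moreover have "\<bar>\<integral>y. G x y \<partial>N'\<bar> \<le> B" if "\<bar>x\<bar> \<le> R" for x
  proof -
    have "AE y in N'. \<bar>G x y\<bar> \<le> B"
      using N(2) B[OF that] by (auto simp: concentrated_def elim!: eventually_mono)
    then have "(\<integral>y. \<bar>G x y\<bar> \<partial>N') \<le> (\<integral>y. B \<partial>N')"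
      using i[of x] by (intro integral_mono_AE) auto
    then show ?thesis
      by (intro order_trans[OF integral_abs_bound]) (simp add: N'.prob_space)
  qed
  ultimately show "integrable N (\<lambda>x. \<integral>y. G x y \<partial>N')"
    by (rule concentrated_integrable[OF N(1)])
qed

lemma concentrated_double_integral_mono:
  assumes N: "concentrated R N" "concentrated S N'"
    and G: "continuous_on UNIV (\<lambda>z. G (fst z) (snd z) :: real)"
    and H: "continuous_on UNIV (\<lambda>z. H (fst z) (snd z) :: real)"
    and le: "\<And>x y. \<bar>x\<bar> \<le> R \<Longrightarrow> \<bar>y\<bar> \<le> S \<Longrightarrow> G x y \<le> H x y"
  shows "(\<integral>x. (\<integral>y. G x y \<partial>N') \<partial>N) \<le> (\<integral>x. (\<integral>y. H x y \<partial>N') \<partial>N)"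
proof (intro integral_mono_AE concentrated_double_integrable[OF N] G H)
  have "AE x in N. \<bar>x\<bar> \<le> R" using N by (simp add: concentrated_def)
  then show "AE x in N. (\<integral>y. G x y \<partial>N') \<le> (\<integral>y. H x y \<partial>N')"
  proof eventually_elim
    case (elim x)
    have "AE y in N'. \<bar>y\<bar> \<le> S" using N by (simp add: concentrated_def)
    then have "AE y in N'. G x y \<le> H x y" by eventually_elim (rule le[OF elim])
    then show ?case by (intro integral_mono_AE concentrated_double_integrable[OF N] G H)
  qed
qed

section \<open>Energy of a measure made of two clusters, and the case of a translation\<close>

lemma energy_translate:
  assumes "prob_meas \<rho>"
  shows "energy p q (translate c \<rho>) = energy p q \<rho>"
proof -
  interpret prob_space \<rho> using assms by (simp add: prob_meas_def)
  have [measurable_cong]: "sets \<rho> = sets borel" using assms by (simp add: prob_meas_def)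
  show ?thesis by (simp add: energy_def translate_def integral_distr)
qed

text \<open>The decomposition is applied to the inner variable and then to the outer one. The two
  cross interactions stay separate iterated integrals, so that the order of integration need not be
  exchanged.\<close>

lemma energy_split:
  assumes pq: "p > 0" "q > 0"
    and M: "concentrated R M" and N0: "concentrated S N0" and N1: "concentrated S N1"
    and split: "\<And>F :: real \<Rightarrow> real. integrable M F \<Longrightarrow>
      (\<integral>x. F x \<partial>M) = m * (\<integral>x. F x \<partial>N0) + (1 - m) * (\<integral>y. F (1 + y) \<partial>N1)"
  shows "2 * energy p q M =
      m\<^sup>2 * (\<integral>x. (\<integral>y. V p q (x - y) \<partial>N0) \<partial>N0)
      + m * (1 - m) * ((\<integral>x. (\<integral>y. V p q (x - 1 - y) \<partial>N1) \<partial>N0) + (\<integral>x. (\<integral>y. V p q (x + 1 - y) \<partial>N0) \<partial>N1))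
      + (1 - m)\<^sup>2 * (\<integral>x. (\<integral>y. V p q (x - y) \<partial>N1) \<partial>N1)"
proof -
  have c: "continuous_on UNIV (\<lambda>z :: real \<times> real. V p q (fst z - snd z))"
    "continuous_on UNIV (\<lambda>z :: real \<times> real. V p q (fst z - 1 - snd z))"
    "continuous_on UNIV (\<lambda>z :: real \<times> real. V p q (fst z + 1 - snd z))"
    by (auto intro!: continuous_on_compose2[OF continuous_V[OF pq]] continuous_intros)
  have inner: "(\<integral>y. V p q (x - y) \<partial>M) = m * (\<integral>y. V p q (x - y) \<partial>N0) + (1 - m) * (\<integral>y. V p q (x - 1 - y) \<partial>N1)" for x
    using split[OF concentrated_double_integrable(1)[OF M M c(1), of x]] by (simp add: algebra_simps)
  note i0 = concentrated_double_integrable(2)[OF M N0 c(1)]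
  note i1 = concentrated_double_integrable(2)[OF M N1 c(2)]
  have "2 * energy p q M = m * (\<integral>x. (\<integral>y. V p q (x - y) \<partial>N0) \<partial>M) + (1 - m) * (\<integral>x. (\<integral>y. V p q (x - 1 - y) \<partial>N1) \<partial>M)"
    unfolding energy_def inner using i0 i1 by simp
  also have "(\<integral>x. (\<integral>y. V p q (x - y) \<partial>N0) \<partial>M)
      = m * (\<integral>x. (\<integral>y. V p q (x - y) \<partial>N0) \<partial>N0) + (1 - m) * (\<integral>x. (\<integral>y. V p q (x + 1 - y) \<partial>N0) \<partial>N1)"
    using split[OF i0] by (simp add: add.commute)
  also have "(\<integral>x. (\<integral>y. V p q (x - 1 - y) \<partial>N1) \<partial>M)
      = m * (\<integral>x. (\<integral>y. V p q (x - 1 - y) \<partial>N1) \<partial>N0) + (1 - m) * (\<integral>x. (\<integral>y. V p q (x - y) \<partial>N1) \<partial>N1)"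
    using split[OF i1] by simp
  finally show ?thesis by (simp add: power2_eq_square algebra_simps)
qed

lemma emeasure_translate_rho_star:
  assumes "0 < m" "m < 1" "A \<in> sets borel"
  shows "emeasure (translate c (rho_star m)) A
      = ennreal m * indicator A c + ennreal (1 - m) * indicator A (1 + c)"
proof -
  have "emeasure (translate c (rho_star m)) A = emeasure (rho_star m) ((\<lambda>x. x + c) -` A)"
    using assms sets_eq_imp_space_eq[OF sets_rho_star[of m]] unfolding translate_def
    by (subst emeasure_distr) (auto simp: measurable_cong_sets[OF sets_rho_star refl])
  also have "\<dots> = ennreal m * indicator ((\<lambda>x. x + c) -` A) 0 + ennreal (1 - m) * indicator ((\<lambda>x. x + c) -` A) 1"
    using assms measurable_sets[of "\<lambda>x. x + c" borel borel A]
    by (intro emeasure_rho_star) auto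
  finally show ?thesis by (simp add: indicator_def)
qed

text \<open>If both clusters collapse to the same offset \<open>c\<close>, testing the decomposition
  on indicator functions gives mass \<open>m\<close> at \<open>c\<close> and mass
  \<open>1 - m\<close> at \<open>1 + c\<close>.\<close>

lemma eq_translate_rho_star:
  assumes m: "0 < m" "m < 1" and M: "prob_meas M"
    and P: "concentrated R N0" "concentrated R N1"
    and split: "\<And>F :: real \<Rightarrow> real. integrable M F \<Longrightarrow>
      (\<integral>x. F x \<partial>M) = m * (\<integral>x. F x \<partial>N0) + (1 - m) * (\<integral>y. F (1 + y) \<partial>N1)"
    and c: "AE x in N0. x = c" "AE x in N1. x = c"
  shows "M = translate c (rho_star m)"
proof (rule measure_eqI)
  interpret prob_space M using M by (simp add: prob_meas_def)
  have sets: "sets M = sets borel" using M by (simp add: prob_meas_def)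
  then show "sets M = sets (translate c (rho_star m))" by (simp add: translate_def)
  fix A assume A: "A \<in> sets M"
  have const: "(\<integral>x. F x \<partial>N) = F c"
    if N: "concentrated R N" "AE x in N. x = c" and F: "F \<in> borel_measurable borel"
    for N :: "real measure" and F :: "real \<Rightarrow> real"
  proof -
    interpret N: prob_space N using N by (simp add: concentrated_def)
    have [measurable_cong]: "sets N = sets borel" using N by (simp add: concentrated_def)
    note [measurable] = F
    have "(\<integral>x. F x \<partial>N) = (\<integral>x. F c \<partial>N)"
      by (intro integral_cong_AE) (use N(2) in auto)
    then show ?thesis by (simp add: N.prob_space)
  qed
  have [measurable]: "A \<in> sets borel" using A sets by simp
  have "integrable M (indicator A :: real \<Rightarrow> real)"
    using A by (intro integrable_real_indicator) (auto simp: emeasure_eq_measure)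
  note split = split[OF this]
  have "prob A = (\<integral>x. indicator A x \<partial>M)" using A by simp
  also have "\<dots> = m * indicator A c + (1 - m) * indicator A (1 + c)"
    unfolding split by (subst const[OF P(1) c(1)], simp, subst const[OF P(2) c(2)]) simp_all
  finally show "emeasure M A = emeasure (translate c (rho_star m)) A"
    using m A sets by (simp add: emeasure_translate_rho_star emeasure_eq_measure ennreal_plus ennreal_mult'' flip: ennreal_indicator)
qed

section \<open>Central moments of one measure and moments of differences\<close>

definition mean :: "real measure \<Rightarrow> real" where
  "mean N = (\<integral>x. x \<partial>N)"

definition central :: "nat \<Rightarrow> real measure \<Rightarrow> real" where
  "central k N = (\<integral>x. (x - mean N) ^ k \<partial>N)"

lemma integrable_centered_power [simp]:
  assumes "concentrated R N" shows "integrable N (\<lambda>x. (x - c) ^ k)"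
  by (rule concentrated_integrable_continuous[OF assms]) (intro continuous_intros)

lemma integrable_id_concentrated [simp]:
  assumes "concentrated R N" shows "integrable N (\<lambda>x. x)"
  by (rule concentrated_integrable_continuous[OF assms]) (intro continuous_intros)

lemma central_0: "concentrated R N \<Longrightarrow> central 0 N = 1"
  and central_1: "concentrated R N \<Longrightarrow> central (Suc 0) N = 0"
proof -
  assume N: "concentrated R N"
  interpret prob_space N using N by (simp add: concentrated_def)
  show "central 0 N = 1" by (simp add: central_def prob_space)
  show "central (Suc 0) N = 0" using N by (simp add: central_def mean_def prob_space)
qed

text \<open>The binomial theorem applied to \<open>x - c = (x - mean N) + (mean N - c)\<close>,
  integrated term by term.\<close>

lemma moment_about:
  assumes N: "concentrated R N"
  shows "(\<integral>x. (x - c) ^ n \<partial>N) = (\<Sum>k\<le>n. of_nat (n choose k) * central k N * (mean N - c) ^ (n - k))"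
proof -
  have "(\<integral>x. (x - c) ^ n \<partial>N) = (\<integral>x. ((x - mean N) + (mean N - c)) ^ n \<partial>N)" by simp
  also have "\<dots> = (\<integral>x. (\<Sum>k\<le>n. of_nat (n choose k) * (x - mean N) ^ k * (mean N - c) ^ (n - k)) \<partial>N)"
    by (simp only: binomial_ring)
  also have "\<dots> = (\<Sum>k\<le>n. of_nat (n choose k) * central k N * (mean N - c) ^ (n - k))"
    using N by (subst Bochner_Integration.integral_sum) (auto simp: central_def integrable_centered_power[OF N])
  finally show ?thesis .
qed

lemma second_moment_about:
  "concentrated R N \<Longrightarrow> (\<integral>x. (x - c)\<^sup>2 \<partial>N) = central 2 N + (mean N - c)\<^sup>2"
  by (subst moment_about) (auto simp: numeral_2_eq_2 central_0 central_1)

lemma third_moment_about: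
  "concentrated R N \<Longrightarrow> (\<integral>x. (x - c) ^ 3 \<partial>N) = central 3 N + 3 * (mean N - c) * central 2 N + (mean N - c) ^ 3"
  by (subst moment_about) (auto simp: numeral_2_eq_2 numeral_3_eq_3 central_0 central_1)

lemma double_second_moment:
  assumes N: "concentrated R N" "concentrated S N'"
  shows "(\<integral>x. (\<integral>y. (y - x)\<^sup>2 \<partial>N') \<partial>N) = central 2 N + central 2 N' + (mean N' - mean N)\<^sup>2"
proof -
  interpret prob_space N using N by (simp add: concentrated_def)
  have "(\<integral>x. (\<integral>y. (y - x)\<^sup>2 \<partial>N') \<partial>N) = (\<integral>x. central 2 N' + (x - mean N')\<^sup>2 \<partial>N)"
    unfolding second_moment_about[OF N(2)] by (simp add: power2_commute)
  also have "\<dots> = central 2 N' + (central 2 N + (mean N - mean N')\<^sup>2)"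
    using N by (simp add: prob_space second_moment_about[OF N(1)] integrable_centered_power[OF N(1)])
  finally show ?thesis by (simp add: power2_commute)
qed

text \<open>This is the third moment of the difference of two independent variables. The inner
  integral is expanded about the mean of \<open>N'\<close>, and the resulting polynomial in
  \<open>x\<close> about the mean of \<open>N\<close>.\<close>

lemma double_third_moment:
  assumes N: "concentrated R N" "concentrated S N'"
  shows "(\<integral>x. (\<integral>y. (y - x) ^ 3 \<partial>N') \<partial>N) = central 3 N' - central 3 N
     + 3 * (mean N' - mean N) * (central 2 N + central 2 N') + (mean N' - mean N) ^ 3"
proof -
  interpret prob_space N using N by (simp add: concentrated_def)
  note i = integrable_centered_power[OF N(1)]
  have i1: "integrable N (\<lambda>x. x - c)" for c using i[of c 1] by simp
  have "(\<integral>x. (\<integral>y. (y - x) ^ 3 \<partial>N') \<partial>N)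
      = (\<integral>x. central 3 N' - 3 * central 2 N' * (x - mean N') ^ 1 - (x - mean N') ^ 3 \<partial>N)"
    unfolding third_moment_about[OF N(2)]
    by (rule Bochner_Integration.integral_cong) (auto simp: power3_eq_cube algebra_simps)
  also have "\<dots> = central 3 N' - 3 * central 2 N' * (\<integral>x. (x - mean N') ^ 1 \<partial>N) - (\<integral>x. (x - mean N') ^ 3 \<partial>N)"
    using i[of _ 3] i1 by (simp add: prob_space)
  also have "(\<integral>x. (x - mean N') ^ 1 \<partial>N) = mean N - mean N'"
    using i N by (simp add: prob_space mean_def)
  also have "central 3 N' - 3 * central 2 N' * (mean N - mean N') - (\<integral>x. (x - mean N') ^ 3 \<partial>N)
      = central 3 N' - central 3 N + 3 * (mean N' - mean N) * (central 2 N + central 2 N') + (mean N' - mean N) ^ 3"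
    unfolding third_moment_about[OF N(1)] by (simp add: power3_eq_cube algebra_simps)
  finally show ?thesis .
qed

lemma central_2_eq_0_imp:
  assumes "concentrated R N" "central 2 N = 0"
  shows "AE x in N. x = mean N"
proof -
  have "AE x in N. (x - mean N)\<^sup>2 = 0"
    using assms by (subst integral_nonneg_eq_0_iff_AE[symmetric]) (auto simp: central_def)
  then show ?thesis by eventually_elim simp
qed

lemma central_2_nonneg: "central 2 N \<ge> 0"
  by (simp add: central_def)

section \<open>The energy gap and a criterion from quadratic bounds\<close>

lemma prob_meas_rho_star:
  assumes "0 < m" "m < 1" shows "prob_meas (rho_star m)"
  by (subst rho_star_eq_atoms[OF assms, of 0 1], simp, rule prob_meas_atoms) (use assms in auto)

lemma cross_interaction_reflect:
  "(\<integral>x. (\<integral>y. V p q (x - 1 - y) \<partial>N1) \<partial>N0) = (\<integral>x. (\<integral>y. V p q (1 + (y - x)) \<partial>N1) \<partial>N0)"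
proof -
  have "V p q (x - 1 - y) = V p q (1 + (y - x))" for x y
    using V_minus[of p q "1 + (y - x)"] by (simp add: algebra_simps)
  then show ?thesis by simp
qed

text \<open>Twice the excess of the energy over that of \<open>rho_star m\<close>, for the measure
  with clusters \<open>N0\<close> around 0 and \<open>N1\<close> around 1. The value of
  \<open>V\<close> at distance 1 is subtracted from each cross term, which leaves only the effect of
  the displacements.\<close>

definition energy_gap :: "real \<Rightarrow> real \<Rightarrow> real \<Rightarrow> real measure \<Rightarrow> real measure \<Rightarrow> real" where
  "energy_gap p q m N0 N1 =
      m\<^sup>2 * (\<integral>x. (\<integral>y. V p q (x - y) \<partial>N0) \<partial>N0)
      + m * (1 - m) * ((\<integral>x. (\<integral>y. V p q (1 + (y - x)) \<partial>N1) \<partial>N0) - V p q 1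
          + ((\<integral>x. (\<integral>y. V p q (1 - (y - x)) \<partial>N0) \<partial>N1) - V p q 1))
      + (1 - m)\<^sup>2 * (\<integral>x. (\<integral>y. V p q (x - y) \<partial>N1) \<partial>N1)"

text \<open>The equality condition says that both clusters are point masses with a common offset,
  which makes the measure a translation of \<open>rho_star m\<close>. Conversely, the energy is
  invariant under translations.\<close>

lemma strict_local_min_rho_starI:
  assumes m: "0 < m" "m < 1" and pq: "p > 0" "q > 0" and \<epsilon>: "0 < \<epsilon>" "\<epsilon> \<le> 1/2"
    and gap: "\<And>N0 N1. concentrated \<epsilon> N0 \<Longrightarrow> concentrated \<epsilon> N1 \<Longrightarrow> 0 \<le> energy_gap p q m N0 N1"
    and eq: "\<And>N0 N1. concentrated \<epsilon> N0 \<Longrightarrow> concentrated \<epsilon> N1 \<Longrightarrow> energy_gap p q m N0 N1 = 0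
      \<Longrightarrow> mean N0 = mean N1 \<and> central 2 N0 = 0 \<and> central 2 N1 = 0"
  shows "strict_local_min p q (rho_star m)"
  unfolding strict_local_min_def
proof (intro exI[of _ \<epsilon>] conjI allI impI)
  fix M assume "prob_meas M \<and> d_inf (rho_star m) M < ereal \<epsilon>"
  then have M: "prob_meas M" and d: "d_inf (rho_star m) M < ereal \<epsilon>" by auto
  obtain N0 N1 where N: "concentrated \<epsilon> N0" "concentrated \<epsilon> N1"
    and split: "\<And>F :: real \<Rightarrow> real. integrable M F \<Longrightarrow>
      (\<integral>x. F x \<partial>M) = m * (\<integral>x. F x \<partial>N0) + (1 - m) * (\<integral>y. F (1 + y) \<partial>N1)"
    using split_near_rho_star[OF m \<epsilon>(2) M d] by metis
  \<comment> \<open>A crude radius containing both clusters; it serves only to make the interaction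
    integrals against \<open>M\<close> finite.\<close>
  have "AE x in M. \<bar>x\<bar> \<le> 2"
    using d_inf_rho_star_less_imp(1)[OF m \<epsilon>(2) M d] by eventually_elim (use \<epsilon> in auto)
  then have "concentrated 2 M" using M by (simp add: concentrated_def prob_meas_def)
  from energy_split[OF pq this N split]
  have E: "2 * energy p q M = 2 * energy p q (rho_star m) + energy_gap p q m N0 N1"
    unfolding energy_gap_def energy_rho_star[OF m] cross_interaction_reflect
    by (simp add: algebra_simps)
  show "energy p q (rho_star m) \<le> energy p q M"
    using E gap[OF N] by simp
  show "energy p q (rho_star m) = energy p q M \<longleftrightarrow> (\<exists>c. M = translate c (rho_star m))"
  proof
    assume "energy p q (rho_star m) = energy p q M"
    with E have "energy_gap p q m N0 N1 = 0" by simp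
    note * = eq[OF N this]
    have "AE x in N0. x = mean N0" "AE x in N1. x = mean N0"
      using * central_2_eq_0_imp[OF N(1)] central_2_eq_0_imp[OF N(2)] by auto
    then show "\<exists>c. M = translate c (rho_star m)"
      using eq_translate_rho_star[OF m M N split] by blast
  next
    assume "\<exists>c. M = translate c (rho_star m)"
    then show "energy p q (rho_star m) = energy p q M"
      using energy_translate[OF prob_meas_rho_star[OF m]] by auto
  qed
qed fact

text \<open>The pointwise bound is needed up to \<open>2 * \<epsilon>\<close> because
  \<open>y - x\<close> is a difference of two points of absolute value at most \<epsilon>.
  Integrating it turns the square into the double second moment.\<close>

lemma double_integral_quadratic_lower_bound:
  assumes N: "concentrated \<epsilon> N" "concentrated \<epsilon> N'" and F: "continuous_on UNIV F"
    and le: "\<And>t. \<bar>t\<bar> \<le> 2 * \<epsilon> \<Longrightarrow> b + a * t\<^sup>2 \<le> (F t :: real)"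
  shows "b + a * (central 2 N + central 2 N' + (mean N' - mean N)\<^sup>2)
    \<le> (\<integral>x. (\<integral>y. F (y - x) \<partial>N') \<partial>N)"
proof -
  interpret N: prob_space N using N by (simp add: concentrated_def)
  interpret N': prob_space N' using N by (simp add: concentrated_def)
  have "integrable N' (\<lambda>y. (y - x)\<^sup>2)" for x :: real
    by (rule integrable_centered_power[OF N(2)])
  moreover have "integrable N (\<lambda>x. \<integral>y. (y - x)\<^sup>2 \<partial>N')"
    by (rule concentrated_double_integrable[OF N]) (intro continuous_intros)
  ultimately have "(\<integral>x. (\<integral>y. b + a * (y - x)\<^sup>2 \<partial>N') \<partial>N) = b + a * (\<integral>x. (\<integral>y. (y - x)\<^sup>2 \<partial>N') \<partial>N)"
    by (simp add: N.prob_space N'.prob_space)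
  also have "\<dots> = b + a * (central 2 N + central 2 N' + (mean N' - mean N)\<^sup>2)"
    unfolding double_second_moment[OF N] ..
  finally have eq: "b + a * (central 2 N + central 2 N' + (mean N' - mean N)\<^sup>2)
      = (\<integral>x. (\<integral>y. b + a * (y - x)\<^sup>2 \<partial>N') \<partial>N)" by simp
  show ?thesis unfolding eq
  proof (rule concentrated_double_integral_mono[OF N])
    show "continuous_on UNIV (\<lambda>z. F (snd z - fst z))"
      by (rule continuous_on_compose2[OF F]) (auto intro!: continuous_intros)
    show "b + a * (y - x)\<^sup>2 \<le> F (y - x)" if "\<bar>x\<bar> \<le> \<epsilon>" "\<bar>y\<bar> \<le> \<epsilon>" for x y
      using that by (intro le) auto
  qed (intro continuous_intros)
qed

text \<open>The gap is bounded below by a linear form in the two variances and the squared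
  difference of means. The conditions relating \<open>a\<close>, \<open>b\<close> and
  \<open>m\<close> say exactly that the coefficients of the variances are positive, and
  \<open>a > 0\<close> handles the means.\<close>

lemma strict_local_min_quadratic:
  assumes m: "0 < m" "m < 1" and pq: "p > 0" "q > 0" and \<epsilon>: "0 < \<epsilon>" "\<epsilon> \<le> 1/2"
    and V1: "\<And>t. \<bar>t\<bar> \<le> 2 * \<epsilon> \<Longrightarrow> V p q 1 + a * t\<^sup>2 \<le> V p q (1 + t)"
    and V0: "\<And>t. \<bar>t\<bar> \<le> 2 * \<epsilon> \<Longrightarrow> - b * t\<^sup>2 \<le> V p q t"
    and ab: "m * b < (1 - m) * a" "(1 - m) * b < m * a" and a: "a > 0"
  shows "strict_local_min p q (rho_star m)"
proof (rule strict_local_min_rho_starI[OF m pq \<epsilon>])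
  fix N0 N1 assume N: "concentrated \<epsilon> N0" "concentrated \<epsilon> N1"
  define v0 v1 d where "v0 = central 2 N0" "v1 = central 2 N1" "d = (mean N1 - mean N0)\<^sup>2"
  have nn: "0 \<le> v0" "0 \<le> v1" "0 \<le> d" by (auto simp: v0_v1_d_def central_2_nonneg)
  have c: "continuous_on UNIV (\<lambda>t. V p q (- t))" "continuous_on UNIV (\<lambda>t. V p q (1 + t))" "continuous_on UNIV (\<lambda>t. V p q (1 - t))"
    by (auto intro!: continuous_on_compose2[OF continuous_V[OF pq]] continuous_intros)
  \<comment> \<open>Within one cluster the difference of means is zero, so the double second moment
    is twice the variance.\<close>
  have 0: "0 + (- b) * (central 2 N + central 2 N + (mean N - mean N)\<^sup>2) \<le> (\<integral>x. (\<integral>y. V p q (- (y - x)) \<partial>N) \<partial>N)"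
    if "concentrated \<epsilon> N" for N
    by (rule double_integral_quadratic_lower_bound[OF that that c(1)]) (use V0 in \<open>simp add: V_minus\<close>)
  have 1: "V p q 1 + a * (v0 + v1 + d) \<le> (\<integral>x. (\<integral>y. V p q (1 + (y - x)) \<partial>N1) \<partial>N0)"
    unfolding v0_v1_d_def
    by (rule double_integral_quadratic_lower_bound[OF N c(2)]) (use V1 in auto)
  have 2: "V p q 1 + a * (v1 + v0 + (mean N0 - mean N1)\<^sup>2) \<le> (\<integral>x. (\<integral>y. V p q (1 - (y - x)) \<partial>N0) \<partial>N1)"
    unfolding v0_v1_d_def
    by (rule double_integral_quadratic_lower_bound[OF N(2,1) c(3)]) (use V1[of "- t" for t] in auto)
  have "V p q 1 + a * (v1 + v0 + (mean N0 - mean N1)\<^sup>2) = V p q 1 + a * (v0 + v1 + d)"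
    by (simp add: v0_v1_d_def power2_commute)
  with 2 have J10: "V p q 1 + a * (v0 + v1 + d) \<le> (\<integral>x. (\<integral>y. V p q (1 - (y - x)) \<partial>N0) \<partial>N1)" by simp
  have "m\<^sup>2 * (- 2 * b * v0) \<le> m\<^sup>2 * (\<integral>x. (\<integral>y. V p q (x - y) \<partial>N0) \<partial>N0)"
    using 0[OF N(1)] by (intro mult_left_mono) (auto simp: v0_v1_d_def)
  moreover have "(1 - m)\<^sup>2 * (- 2 * b * v1) \<le> (1 - m)\<^sup>2 * (\<integral>x. (\<integral>y. V p q (x - y) \<partial>N1) \<partial>N1)"
    using 0[OF N(2)] by (intro mult_left_mono) (auto simp: v0_v1_d_def)
  moreover have "m * (1 - m) * (2 * a * (v0 + v1 + d)) \<le>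
      m * (1 - m) * ((\<integral>x. (\<integral>y. V p q (1 + (y - x)) \<partial>N1) \<partial>N0) - V p q 1
          + ((\<integral>x. (\<integral>y. V p q (1 - (y - x)) \<partial>N0) \<partial>N1) - V p q 1))"
    using 1 J10 m by (intro mult_left_mono) auto
  ultimately have "m\<^sup>2 * (- 2 * b * v0) + m * (1 - m) * (2 * a * (v0 + v1 + d)) + (1 - m)\<^sup>2 * (- 2 * b * v1)
      \<le> energy_gap p q m N0 N1"
    unfolding energy_gap_def by linarith
  then have le: "2 * m * ((1 - m) * a - m * b) * v0 + 2 * (1 - m) * (m * a - (1 - m) * b) * v1
      + 2 * m * (1 - m) * a * d \<le> energy_gap p q m N0 N1"
    by (simp add: power2_eq_square algebra_simps)
  have pos: "2 * m * ((1 - m) * a - m * b) > 0" "2 * (1 - m) * (m * a - (1 - m) * b) > 0" "2 * m * (1 - m) * a > 0"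
    using m ab a by simp_all
  have nn': "0 \<le> 2 * m * ((1 - m) * a - m * b) * v0" "0 \<le> 2 * (1 - m) * (m * a - (1 - m) * b) * v1" "0 \<le> 2 * m * (1 - m) * a * d"
    using mult_nonneg_nonneg[OF less_imp_le[OF pos(1)] nn(1)] mult_nonneg_nonneg[OF less_imp_le[OF pos(2)] nn(2)]
      mult_nonneg_nonneg[OF less_imp_le[OF pos(3)] nn(3)] by auto
  with le show "0 \<le> energy_gap p q m N0 N1" by linarith
  assume "energy_gap p q m N0 N1 = 0"
  with le nn' have "2 * m * ((1 - m) * a - m * b) * v0 = 0" "2 * (1 - m) * (m * a - (1 - m) * b) * v1 = 0" "2 * m * (1 - m) * a * d = 0"
    by linarith+
  with pos have "v0 = 0" "v1 = 0" "d = 0" by auto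
  then show "mean N0 = mean N1 \<and> central 2 N0 = 0 \<and> central 2 N1 = 0" by (simp add: v0_v1_d_def)
qed

subsection \<open>The cubic case\<close>

text \<open>
  The correction terms \<open>(max u 0)\<^sup>2 v\<close> are chosen to integrate to zero against centred measures.
\<close>

lemma cubic_kernel_lower_bound:
  fixes u v R :: real
  assumes "\<bar>u\<bar> \<le> R" "\<bar>v\<bar> \<le> R" "R > 0"
  shows "u ^ 3 + v ^ 3 - 3 * (max u 0)\<^sup>2 * v - 3 * (max v 0)\<^sup>2 * u + u\<^sup>2 * v\<^sup>2 / R \<le> \<bar>u - v\<bar> ^ 3"
proof -
  \<comment> \<open>Both sides are symmetric in \<open>u\<close> and \<open>v\<close>, so it
    suffices to treat \<open>v\<close> \<le> \<open>u\<close>, where the absolute value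
    disappears.\<close>
  have main: "u ^ 3 + v ^ 3 - 3 * (max u 0)\<^sup>2 * v - 3 * (max v 0)\<^sup>2 * u + u\<^sup>2 * v\<^sup>2 / R \<le> (u - v) ^ 3"
    if uv: "v \<le> u" "\<bar>u\<bar> \<le> R" "\<bar>v\<bar> \<le> R" for u v :: real
  proof -
    \<comment> \<open>Division by \<open>R\<close> absorbs one bounded factor and turns the quartic
      correction into a cubic term.\<close>
    have R: "s * t / R \<le> t" if "\<bar>s\<bar> \<le> R" "t \<ge> 0" for s t :: real
    proof -
      have "s * t \<le> R * t" using that by (intro mult_right_mono) auto
      then show ?thesis using \<open>R > 0\<close> by (simp add: field_simps)
    qed
    consider "0 \<le> v" | "v < 0" "0 \<le> u" | "u < 0" using uv by linarith
    then show ?thesis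
    proof cases
      case 1
      have "u * (u * v\<^sup>2) / R \<le> u * v\<^sup>2" using 1 uv by (intro R) auto
      then have "u\<^sup>2 * v\<^sup>2 / R \<le> u * v\<^sup>2" by (simp add: power2_eq_square mult_ac)
      moreover have "v * v\<^sup>2 \<le> u * v\<^sup>2" using uv by (intro mult_right_mono) auto
      moreover have "v * v\<^sup>2 = v ^ 3" by (simp add: power2_eq_square power3_eq_cube)
      moreover have "0 \<le> u * v\<^sup>2" using 1 uv by auto
      moreover have "(u - v) ^ 3 = u ^ 3 - 3 * u\<^sup>2 * v + 3 * (u * v\<^sup>2) - v ^ 3"
        by (simp add: power2_eq_square power3_eq_cube algebra_simps)
      moreover have "3 * v\<^sup>2 * u = 3 * (u * v\<^sup>2)" by simp
      moreover have "max u 0 = u" "max v 0 = v" using 1 uv by auto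
      ultimately show ?thesis by (simp only:)
    next
      case 2
      have "u * (u * v\<^sup>2) / R \<le> u * v\<^sup>2" using 2 uv by (intro R) auto
      then have "u\<^sup>2 * v\<^sup>2 / R \<le> u * v\<^sup>2" by (simp add: power2_eq_square mult_ac)
      moreover have "v ^ 3 \<le> 0" using 2 by (simp add: power3_eq_cube mult_nonneg_nonpos mult_nonpos_nonpos)
      moreover have "0 \<le> u * v\<^sup>2" using 2 uv by auto
      moreover have "(u - v) ^ 3 = u ^ 3 - 3 * u\<^sup>2 * v + 3 * (u * v\<^sup>2) - v ^ 3"
        by (simp add: power2_eq_square power3_eq_cube algebra_simps)
      moreover have "3 * (0::real)\<^sup>2 * u = 0" by simp
      moreover have "max u 0 = u" "max v 0 = 0" using 2 by auto
      ultimately show ?thesis by (simp only:)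
    next
      case 3
      have "0 \<le> (- v) * u\<^sup>2" using 3 uv by (intro mult_nonneg_nonneg) auto
      then have "(- v) * ((- v) * u\<^sup>2) / R \<le> (- v) * u\<^sup>2" using uv by (intro R) auto
      \<comment> \<open>The difference of the two sides contains
        \<open>(- v) * (2 * v^2 - 3 * u * v + 3 * u^2)\<close>. One copy of
        \<open>(- v) * u^2\<close> pays for the quartic term, and the remaining quadratic form is
        nonnegative.\<close>
      moreover have "0 \<le> (- v) * (2 * v\<^sup>2 - 3 * u * v + 2 * u\<^sup>2)"
      proof (intro mult_nonneg_nonneg)
        have "2 * v\<^sup>2 - 3 * u * v + 2 * u\<^sup>2 = (v\<^sup>2 + u\<^sup>2) / 2 + 3/2 * (u - v)\<^sup>2"
          by (simp add: power2_eq_square field_simps)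
        also have "\<dots> \<ge> 0" by simp
        finally show "0 \<le> 2 * v\<^sup>2 - 3 * u * v + 2 * u\<^sup>2" .
      qed (use 3 uv in auto)
      ultimately show ?thesis using 3 uv
        by (simp add: max_def power2_eq_square power3_eq_cube algebra_simps)
    qed
  qed
  show ?thesis
  proof (cases "v \<le> u")
    case True then show ?thesis using main[OF True] assms by simp
  next
    case False
    then show ?thesis using main[of u v] assms by (simp add: abs_minus_commute algebra_simps)
  qed
qed

lemma abs_mean_le:
  assumes N: "concentrated R N" shows "\<bar>mean N\<bar> \<le> R"
proof -
  interpret prob_space N using N by (simp add: concentrated_def)
  have "AE x in N. \<bar>x\<bar> \<le> R" using N by (simp add: concentrated_def)
  then have "(\<integral>x. \<bar>x\<bar> \<partial>N) \<le> (\<integral>x. R \<partial>N)"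
    using N by (intro integral_mono_AE) auto
  then show ?thesis
    unfolding mean_def by (intro order_trans[OF integral_abs_bound]) (simp add: prob_space)
qed

text \<open>\<open>cubic_kernel_lower_bound\<close> is integrated with \<open>u\<close> the centred
  variable, bounded by \<open>2 * \<epsilon>\<close>. The mixed terms vanish because
  \<open>u\<close> has mean zero, and the quartic term yields the squared variance. Reflecting by
  \<open>s\<close> provides the bound for either sign of the third moment.\<close>

lemma double_integral_abs_cube_lower_bound:
  assumes N: "concentrated \<epsilon> N" and \<epsilon>: "\<epsilon> > 0" and s: "s \<in> {1, - 1 :: real}"
  shows "2 * s * central 3 N + (central 2 N)\<^sup>2 / (2 * \<epsilon>) \<le> (\<integral>x. (\<integral>y. \<bar>x - y\<bar> ^ 3 \<partial>N) \<partial>N)"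
proof -
  interpret prob_space N using N by (simp add: concentrated_def)
  define u where "u x = s * (x - mean N)" for x
  define f where "f x = 3 * (max (u x) 0)\<^sup>2" for x
  have cont: "continuous_on UNIV u" "continuous_on UNIV f"
    unfolding u_def f_def by (intro continuous_intros)+
  have cu [continuous_intros]: "continuous_on A (\<lambda>x. u (g x))" "continuous_on A (\<lambda>x. f (g x))"
    if "continuous_on A g" for A and g :: "real \<times> real \<Rightarrow> real"
    by (auto intro!: continuous_on_compose2[OF cont(1)] continuous_on_compose2[OF cont(2)] that)
  have i: "integrable N (\<lambda>x. u x ^ k)" "integrable N f" "integrable N u" for k
    by (intro concentrated_integrable_continuous[OF N] continuous_intros cont)+
  have s2: "s\<^sup>2 = 1" "s ^ 3 = s" using s by auto
  have Iu: "(\<integral>x. u x \<partial>N) = 0" "(\<integral>x. (u x)\<^sup>2 \<partial>N) = central 2 N" "(\<integral>x. (u x) ^ 3 \<partial>N) = s * central 3 N"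
    using central_1[OF N] by (simp_all add: u_def power_mult_distrib s2 central_def)
  have ub: "\<bar>u x\<bar> \<le> 2 * \<epsilon>" if "\<bar>x\<bar> \<le> \<epsilon>" for x
    using that s abs_mean_le[OF N] by (auto simp: u_def)
  have inner: "(\<integral>y. u x ^ 3 + u y ^ 3 - f x * u y - f y * u x + (u x)\<^sup>2 * (u y)\<^sup>2 / (2 * \<epsilon>) \<partial>N)
      = u x ^ 3 + s * central 3 N - (\<integral>y. f y \<partial>N) * u x + (u x)\<^sup>2 * (central 2 N / (2 * \<epsilon>))" for x
    using i by (simp add: prob_space Iu)
  have "(\<integral>x. (\<integral>y. u x ^ 3 + u y ^ 3 - f x * u y - f y * u x + (u x)\<^sup>2 * (u y)\<^sup>2 / (2 * \<epsilon>) \<partial>N) \<partial>N)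
      = 2 * s * central 3 N + (central 2 N)\<^sup>2 / (2 * \<epsilon>)"
    unfolding inner using i by (simp add: prob_space Iu) (simp add: power2_eq_square)
  moreover have "(\<integral>x. (\<integral>y. u x ^ 3 + u y ^ 3 - f x * u y - f y * u x + (u x)\<^sup>2 * (u y)\<^sup>2 / (2 * \<epsilon>) \<partial>N) \<partial>N)
      \<le> (\<integral>x. (\<integral>y. \<bar>x - y\<bar> ^ 3 \<partial>N) \<partial>N)"
  proof (rule concentrated_double_integral_mono[OF N N])
    fix x y assume xy: "\<bar>x\<bar> \<le> \<epsilon>" "\<bar>y\<bar> \<le> \<epsilon>"
    have "\<bar>u x - u y\<bar> = \<bar>x - y\<bar>" using s by (auto simp: u_def)
    then show "u x ^ 3 + u y ^ 3 - f x * u y - f y * u x + (u x)\<^sup>2 * (u y)\<^sup>2 / (2 * \<epsilon>) \<le> \<bar>x - y\<bar> ^ 3"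
      using cubic_kernel_lower_bound[OF ub[OF xy(1)] ub[OF xy(2)]] \<epsilon> by (simp add: f_def)
  qed (use \<epsilon> in \<open>auto intro!: continuous_intros\<close>)
  ultimately show ?thesis by simp
qed

lemma V_3_2: "V 3 2 x = \<bar>x\<bar> ^ 3 / 3 - x\<^sup>2 / 2"
  by (cases "x = 0") (simp_all add: V_def)

text \<open>The cross interaction contributes the variances with coefficient exactly opposite to
  that of the self-interactions. Positivity therefore rests on the squared variances from the cubic
  self-interaction and on the squared difference of means.\<close>

lemma strict_local_min_cubic: "strict_local_min 3 2 (rho_star (1/2))"
\<comment> \<open>This radius gives the squared variances the coefficient 50/3, well above the 4
  used to absorb the products of \<open>d\<close> with a variance. It also keeps \<open>d\<close> so
  small that its cube is dominated by its square.\<close>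
proof (rule strict_local_min_rho_starI[where \<epsilon> = "1/100"])
  let ?e = "1/100 :: real"
  fix N0 N1 assume N: "concentrated ?e N0" "concentrated ?e N1"
  have self: "2 * s * central 3 N / 3 + 50 * (central 2 N)\<^sup>2 / 3 - central 2 N \<le> (\<integral>x. (\<integral>y. V 3 2 (x - y) \<partial>N) \<partial>N)"
    if N: "concentrated ?e N" and s: "s \<in> {1, - 1}" for N s
  proof -
    have c: "continuous_on UNIV (\<lambda>z :: real \<times> real. \<bar>fst z - snd z\<bar> ^ 3)"
      "continuous_on UNIV (\<lambda>z :: real \<times> real. (snd z - fst z)\<^sup>2)" by (intro continuous_intros)+
    note i = concentrated_double_integrable[OF N N c(1)] concentrated_double_integrable[OF N N c(2)]
    have "(\<integral>x. (\<integral>y. V 3 2 (x - y) \<partial>N) \<partial>N) = (\<integral>x. (\<integral>y. \<bar>x - y\<bar> ^ 3 / 3 - (y - x)\<^sup>2 / 2 \<partial>N) \<partial>N)"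
      by (simp add: V_3_2 power2_commute)
    also have "\<dots> = (\<integral>x. (\<integral>y. \<bar>x - y\<bar> ^ 3 \<partial>N) \<partial>N) / 3 - (\<integral>x. (\<integral>y. (y - x)\<^sup>2 \<partial>N) \<partial>N) / 2"
      using i by simp
    finally show ?thesis
      using double_integral_abs_cube_lower_bound[OF N _ s] unfolding double_second_moment[OF N N] by simp
  qed
  have cross: "(\<integral>x. (\<integral>y. V 3 2 (1 + t * (y - x)) \<partial>N') \<partial>N) - V 3 2 1
      = (central 2 N + central 2 N' + (mean N' - mean N)\<^sup>2) / 2
        + t * (central 3 N' - central 3 N + 3 * (mean N' - mean N) * (central 2 N + central 2 N') + (mean N' - mean N) ^ 3) / 3"
    if N: "concentrated ?e N" "concentrated ?e N'" and t: "t \<in> {1, - 1}" for N N' and t :: real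
  proof -
    interpret N: prob_space N using N by (simp add: concentrated_def)
    interpret N': prob_space N' using N by (simp add: concentrated_def)
    let ?H = "\<lambda>x y. V 3 2 1 + (y - x)\<^sup>2 / 2 + t * (y - x) ^ 3 / 3"
    \<comment> \<open>The argument \<open>1 + t * (y - x)\<close> stays positive, so the potential
      is exactly a cubic polynomial there and the cross term has no remainder.\<close>
    have eq: "V 3 2 (1 + t * (y - x)) = ?H x y" if "\<bar>x\<bar> \<le> ?e" "\<bar>y\<bar> \<le> ?e" for x y
    proof -
      have "\<bar>1 + t * (y - x)\<bar> = 1 + t * (y - x)" using that t by auto
      then show ?thesis using t
        by (auto simp: V_3_2 power2_eq_square power3_eq_cube field_simps)
    qed
    have cH: "continuous_on UNIV (\<lambda>z. ?H (fst z) (snd z))"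
      and cV: "continuous_on UNIV (\<lambda>z. V 3 2 (1 + t * (snd z - fst z)))"
      and c: "continuous_on UNIV (\<lambda>z :: real \<times> real. (snd z - fst z)\<^sup>2)"
        "continuous_on UNIV (\<lambda>z :: real \<times> real. (snd z - fst z) ^ 3)"
      by (auto intro!: continuous_intros continuous_on_compose2[OF continuous_V])
    have "(\<integral>x. (\<integral>y. V 3 2 (1 + t * (y - x)) \<partial>N') \<partial>N) = (\<integral>x. (\<integral>y. ?H x y \<partial>N') \<partial>N)"
      by (intro antisym concentrated_double_integral_mono[OF N] cV cH) (simp_all add: eq)
    also have "\<dots> = V 3 2 1 + (\<integral>x. (\<integral>y. (y - x)\<^sup>2 \<partial>N') \<partial>N) / 2 + t * (\<integral>x. (\<integral>y. (y - x) ^ 3 \<partial>N') \<partial>N) / 3"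
      using concentrated_double_integrable[OF N c(1)] concentrated_double_integrable[OF N c(2)]
      by (simp add: N.prob_space N'.prob_space)
    finally show ?thesis
      unfolding double_second_moment[OF N] double_third_moment[OF N] by simp
  qed
  define v0 v1 d where "v0 = central 2 N0" "v1 = central 2 N1" "d = mean N1 - mean N0"
  note defs = v0_v1_d_def
  have "mean N0 - mean N1 = - d" by (simp add: defs)
  then have lower: "50 * v0\<^sup>2 / 3 + 50 * v1\<^sup>2 / 3 + d\<^sup>2 + 2 * d * (v0 + v1) + 2 * d ^ 3 / 3 \<le> 4 * energy_gap 3 2 (1/2) N0 N1"
  proof -
    define c0 c1 where "c0 = central 3 N0" "c1 = central 3 N1"
    \<comment> \<open>The sign \<open>s\<close> is 1 for \<open>N0\<close> and -1 for
      \<open>N1\<close>. With these choices the third central moments cancel those of the two cross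
      terms.\<close>
    have J: "2 * c0 / 3 + 50 * v0\<^sup>2 / 3 - v0 \<le> (\<integral>x. (\<integral>y. V 3 2 (x - y) \<partial>N0) \<partial>N0)"
      "- 2 * c1 / 3 + 50 * v1\<^sup>2 / 3 - v1 \<le> (\<integral>x. (\<integral>y. V 3 2 (x - y) \<partial>N1) \<partial>N1)"
      using self[OF N(1), of 1] self[OF N(2), of "-1"] unfolding defs c0_c1_def by simp_all
    have K: "(\<integral>x. (\<integral>y. V 3 2 (1 + (y - x)) \<partial>N1) \<partial>N0) - V 3 2 1
        = (v0 + v1 + d\<^sup>2) / 2 + (c1 - c0 + 3 * d * (v0 + v1) + d ^ 3) / 3"
      using cross[OF N, of 1] unfolding defs c0_c1_def by simp
    have "(\<integral>x. (\<integral>y. V 3 2 (1 + - 1 * (y - x)) \<partial>N0) \<partial>N1) - V 3 2 1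
        = (v1 + v0 + (- d)\<^sup>2) / 2 + - 1 * (c0 - c1 + 3 * (- d) * (v1 + v0) + (- d) ^ 3) / 3"
      using cross[OF N(2,1), of "-1"] unfolding \<open>mean N0 - mean N1 = - d\<close> v0_v1_d_def(1,2)[symmetric] c0_c1_def[symmetric] by blast
    moreover have "(\<integral>x. (\<integral>y. V 3 2 (1 + - 1 * (y - x)) \<partial>N0) \<partial>N1) = (\<integral>x. (\<integral>y. V 3 2 (1 - (y - x)) \<partial>N0) \<partial>N1)"
      by (simp add: algebra_simps)
    ultimately have "(\<integral>x. (\<integral>y. V 3 2 (1 - (y - x)) \<partial>N0) \<partial>N1) - V 3 2 1
        = (v1 + v0 + (- d)\<^sup>2) / 2 + - 1 * (c0 - c1 + 3 * (- d) * (v1 + v0) + (- d) ^ 3) / 3"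
      by simp
    also have "\<dots> = (v0 + v1 + d\<^sup>2) / 2 + (c1 - c0 + 3 * d * (v0 + v1) + d ^ 3) / 3"
      by (simp add: field_simps)
    finally show ?thesis
      using J K unfolding energy_gap_def by (simp add: power2_eq_square algebra_simps)
  qed
  have "\<bar>d\<bar> \<le> 1/50" using abs_mean_le[OF N(1)] abs_mean_le[OF N(2)] unfolding defs by linarith
  then have "d\<^sup>2 * (- (1/50)) \<le> d\<^sup>2 * d" by (intro mult_left_mono) auto
  moreover have "d\<^sup>2 * d = d ^ 3" by (simp add: power2_eq_square power3_eq_cube)
  \<comment> \<open>Completing the square bounds each product \<open>2 * d * v\<close> below by
    \<open>- d^2 / 4 - 4 * v^2\<close>, leaving a positive multiple of every square.\<close>
  moreover have "0 \<le> (d / 2 + 2 * v0)\<^sup>2" "0 \<le> (d / 2 + 2 * v1)\<^sup>2" by auto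
  then have "0 \<le> d\<^sup>2 / 4 + 2 * (d * v0) + 4 * v0\<^sup>2" "0 \<le> d\<^sup>2 / 4 + 2 * (d * v1) + 4 * v1\<^sup>2"
    by (simp_all add: power2_eq_square algebra_simps)
  moreover have "2 * d * (v0 + v1) = 2 * (d * v0) + 2 * (d * v1)" by (simp add: algebra_simps)
  ultimately have "v0\<^sup>2 + v1\<^sup>2 + d\<^sup>2 / 4 \<le> 4 * energy_gap 3 2 (1/2) N0 N1"
    using lower zero_le_power2[of v0] zero_le_power2[of v1] zero_le_power2[of d] by linarith
  moreover have "0 \<le> v0\<^sup>2" "0 \<le> v1\<^sup>2" "0 \<le> d\<^sup>2" by auto
  ultimately have *: "0 \<le> energy_gap 3 2 (1/2) N0 N1"
    "energy_gap 3 2 (1/2) N0 N1 = 0 \<Longrightarrow> v0\<^sup>2 = 0 \<and> v1\<^sup>2 = 0 \<and> d\<^sup>2 = 0"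
    by linarith+
  show "0 \<le> energy_gap 3 2 (1/2) N0 N1" by fact
  assume "energy_gap 3 2 (1/2) N0 N1 = 0"
  with *(2) show "mean N0 = mean N1 \<and> central 2 N0 = 0 \<and> central 2 N1 = 0" by (simp add: defs)
qed simp_all

subsection \<open>Expansions of the potential and splitting an atom\<close>

lemma powr_taylor_2:
  fixes p :: real assumes "p \<ge> 2"
  shows "((\<lambda>t. ((1 + t) powr p - 1 - p * t) / t\<^sup>2) \<longlongrightarrow> p * (p - 1) / 2) (at 0)"
  using assms by real_asymp

lemma powr_taylor_3:
  fixes p :: real assumes "p \<ge> 2"
  shows "((\<lambda>t. ((1 + t) powr p - 1 - p * t - p * (p - 1) / 2 * t\<^sup>2) / t ^ 3) \<longlongrightarrow> p * (p - 1) * (p - 2) / 6) (at 0)"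
  using assms by real_asymp

lemma V_near_1: "\<bar>t\<bar> < 1 \<Longrightarrow> V p q (1 + t) = (1 + t) powr p / p - (1 + t) powr q / q"
  by (simp add: V_def)

text \<open>The first derivative of \<open>V\<close> vanishes at 1, since both linear terms equal
  \<open>t\<close> after division by the exponents. The limit is half of the second derivative
  \<open>p - q\<close>.\<close>

lemma V_taylor_2_at_1:
  assumes "p \<ge> 2" "q \<ge> 2"
  shows "((\<lambda>t. (V p q (1 + t) - V p q 1) / t\<^sup>2) \<longlongrightarrow> (p - q) / 2) (at 0)"
proof -
  have "((\<lambda>t. ((1 + t) powr p - 1 - p * t) / t\<^sup>2 / p - ((1 + t) powr q - 1 - q * t) / t\<^sup>2 / q)
      \<longlongrightarrow> p * (p - 1) / 2 / p - q * (q - 1) / 2 / q) (at 0)"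
    using assms by (intro tendsto_intros powr_taylor_2) auto
  moreover have "\<forall>\<^sub>F t in at 0. ((1 + t) powr p - 1 - p * t) / t\<^sup>2 / p - ((1 + t) powr q - 1 - q * t) / t\<^sup>2 / q
      = (V p q (1 + t) - V p q 1) / t\<^sup>2"
    unfolding eventually_at
  proof (intro exI[of _ 1] conjI ballI impI)
    fix t :: real assume t: "t \<noteq> 0 \<and> dist t 0 < 1"
    then have "V p q (1 + t) = (1 + t) powr p / p - (1 + t) powr q / q" by (intro V_near_1) auto
    moreover have "V p q 1 = 1 / p - 1 / q" by (simp add: V_def)
    ultimately have "((1 + t) powr p - 1 - p * t) / p - ((1 + t) powr q - 1 - q * t) / q = V p q (1 + t) - V p q 1"
      using assms by (simp add: diff_divide_distrib)
    then show "((1 + t) powr p - 1 - p * t) / t\<^sup>2 / p - ((1 + t) powr q - 1 - q * t) / t\<^sup>2 / q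
      = (V p q (1 + t) - V p q 1) / t\<^sup>2"
      by (metis diff_divide_distrib divide_divide_eq_left mult.commute)
  qed auto
  ultimately have "((\<lambda>t. (V p q (1 + t) - V p q 1) / t\<^sup>2) \<longlongrightarrow> p * (p - 1) / 2 / p - q * (q - 1) / 2 / q) (at 0)"
    by (rule Lim_transform_eventually)
  moreover have "p * (p - 1) / 2 / p - q * (q - 1) / 2 / q = (p - q) / 2"
    using assms by (simp add: diff_divide_distrib)
  ultimately show ?thesis by (simp only:)
qed

text \<open>For \<open>q = 2\<close> the attractive part is itself quadratic, so the cubic
  coefficient comes from the power \<open>p\<close> alone.\<close>

lemma V_taylor_3_at_1:
  assumes "p \<ge> 2"
  shows "((\<lambda>t. (V p 2 (1 + t) - V p 2 1 - (p - 2) / 2 * t\<^sup>2) / t ^ 3) \<longlongrightarrow> (p - 1) * (p - 2) / 6) (at 0)"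
proof -
  have "((\<lambda>t. ((1 + t) powr p - 1 - p * t - p * (p - 1) / 2 * t\<^sup>2) / t ^ 3 / p)
      \<longlongrightarrow> p * (p - 1) * (p - 2) / 6 / p) (at 0)"
    using assms by (intro tendsto_intros powr_taylor_3) auto
  moreover have "\<forall>\<^sub>F t in at 0. ((1 + t) powr p - 1 - p * t - p * (p - 1) / 2 * t\<^sup>2) / t ^ 3 / p
      = (V p 2 (1 + t) - V p 2 1 - (p - 2) / 2 * t\<^sup>2) / t ^ 3"
    unfolding eventually_at
  proof (intro exI[of _ 1] conjI ballI impI)
    fix t :: real assume t: "t \<noteq> 0 \<and> dist t 0 < 1"
    then have "V p 2 (1 + t) = (1 + t) powr p / p - (1 + t)\<^sup>2 / 2" by (subst V_near_1) auto
    moreover have "V p 2 1 = 1 / p - 1 / 2" by (simp add: V_def)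
    ultimately have "((1 + t) powr p - 1 - p * t - p * (p - 1) / 2 * t\<^sup>2) / p = V p 2 (1 + t) - V p 2 1 - (p - 2) / 2 * t\<^sup>2"
      using assms by (simp add: field_simps power2_eq_square)
    then show "((1 + t) powr p - 1 - p * t - p * (p - 1) / 2 * t\<^sup>2) / t ^ 3 / p
      = (V p 2 (1 + t) - V p 2 1 - (p - 2) / 2 * t\<^sup>2) / t ^ 3"
      by (metis divide_divide_eq_left mult.commute)
  qed auto
  ultimately have "((\<lambda>t. (V p 2 (1 + t) - V p 2 1 - (p - 2) / 2 * t\<^sup>2) / t ^ 3) \<longlongrightarrow> p * (p - 1) * (p - 2) / 6 / p) (at 0)"
    by (rule Lim_transform_eventually)
  then show ?thesis using assms by simp
qed

lemma V_lower_bound_at_1: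
  assumes "p \<ge> 2" "q \<ge> 2" "a < (p - q) / 2"
  obtains \<delta> where "\<delta> > 0" "\<And>t. \<bar>t\<bar> < \<delta> \<Longrightarrow> V p q 1 + a * t\<^sup>2 \<le> V p q (1 + t)"
proof -
  have "\<forall>\<^sub>F t in at 0. a < (V p q (1 + t) - V p q 1) / t\<^sup>2"
    using V_taylor_2_at_1[OF assms(1,2)] assms(3) by (rule order_tendstoD)
  then obtain \<delta> where \<delta>: "\<delta> > 0" "\<And>t. t \<noteq> 0 \<Longrightarrow> \<bar>t\<bar> < \<delta> \<Longrightarrow> a < (V p q (1 + t) - V p q 1) / t\<^sup>2"
    unfolding eventually_at by auto
  show ?thesis
  proof (rule that[OF \<delta>(1)])
    fix t :: real assume "\<bar>t\<bar> < \<delta>"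
    then show "V p q 1 + a * t\<^sup>2 \<le> V p q (1 + t)"
      using \<delta>(2)[of t] by (cases "t = 0") (auto simp: field_simps)
  qed
qed

text \<open>The term with exponent \<open>p\<close> is nonnegative, and for \<open>q > 2\<close> the
  negative term is of smaller order than the square. Hence \<open>b\<close> can be taken arbitrarily
  small.\<close>

lemma V_lower_bound_at_0:
  assumes "p > 0" "q > 2" "b > 0"
  obtains \<delta> where "\<delta> > 0" "\<And>t. \<bar>t\<bar> < \<delta> \<Longrightarrow> - b * t\<^sup>2 \<le> V p q t"
proof -
  have "((\<lambda>t. t powr q / q / t\<^sup>2) \<longlongrightarrow> 0) (at_right 0)" using assms(2) by real_asymp
  then have "\<forall>\<^sub>F t in at_right 0. t powr q / q / t\<^sup>2 < b"
    using \<open>b > 0\<close> by (rule order_tendstoD)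
  then obtain \<delta> where \<delta>: "\<delta> > 0" "\<And>t. 0 < t \<Longrightarrow> t < \<delta> \<Longrightarrow> t powr q / q / t\<^sup>2 < b"
    unfolding eventually_at_right_field by blast
  show ?thesis
  proof (rule that[OF \<delta>(1)])
    fix t :: real assume t: "\<bar>t\<bar> < \<delta>"
    show "- b * t\<^sup>2 \<le> V p q t"
    proof (cases "t = 0")
      case False
      then have "\<bar>t\<bar> powr q / q < b * t\<^sup>2" using \<delta>(2)[of "\<bar>t\<bar>"] t
        by (simp add: pos_divide_less_eq del: divide_divide_eq_left)
      moreover have "0 \<le> \<bar>t\<bar> powr p / p" using assms by simp
      ultimately show ?thesis by (simp add: V_def)
    qed simp
  qed
qed

lemma V_2_lower_bound:
  assumes "p > 0" shows "- (1/2) * t\<^sup>2 \<le> V p 2 t"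
proof -
  have "\<bar>t\<bar> powr 2 = t\<^sup>2" by (cases "t = 0") simp_all
  then show ?thesis using assms by (simp add: V_def)
qed

section \<open>Lowering the energy by splitting one atom\<close>

definition split_weight :: "real \<Rightarrow> nat \<Rightarrow> real" where
  "split_weight m i = (if i = 0 then m / 3 else if i = 1 then 2 * m / 3 else 1 - m)"

text \<open>The energy change, divided by \<open>m\<close>, when the atom of mass \<open>m\<close>
  is split with weights 1:2 and displacements \<open>2 * h\<close> towards the other atom and
  \<open>- h\<close> away from it. These preserve the centre of mass but give a nonzero third
  moment.\<close>

definition split_gain :: "real \<Rightarrow> real \<Rightarrow> real \<Rightarrow> real" where
  "split_gain p m h = 2 * m / 9 * V p 2 (3 * h)
     + (1 - m) * ((V p 2 (1 - 2 * h) + 2 * V p 2 (1 + h)) / 3 - V p 2 1)"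

text \<open>The coefficient of the square of \<open>h\<close> is
  \<open>(1 - m) * (p - 2) - m\<close>. If it is zero, the cubic term decides: the skew splitting
  makes it negative, and \<open>p > 3\<close> makes the self-repulsion of the two pieces of smaller
  order.\<close>

lemma eventually_split_gain_neg:
  assumes m: "0 < m" "m < 1" and p: "p > 2"
    and cond: "(1 - m) * (p - 2) < m \<or> (1 - m) * (p - 2) = m \<and> p > 3"
  shows "\<forall>\<^sub>F h in at_right 0. split_gain p m h < 0"
proof -
  define r where "r t = (V p 2 (1 + t) - V p 2 1 - (p - 2) / 2 * t\<^sup>2) / t ^ 3" for t
  have r: "(r \<longlongrightarrow> (p - 1) * (p - 2) / 6) (at 0)"
    unfolding r_def using p by (intro V_taylor_3_at_1) auto
  have r1: "(r \<longlongrightarrow> (p - 1) * (p - 2) / 6) (at_right 0)"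
    using r by (rule filterlim_mono) (auto simp: at_within_le_at)
  have "filterlim (\<lambda>h :: real. - 2 * h) (at 0) (at_right 0)" by real_asymp
  with r have r2: "((\<lambda>h. r (- 2 * h)) \<longlongrightarrow> (p - 1) * (p - 2) / 6) (at_right 0)"
    by (rule filterlim_compose)
  \<comment> \<open>This includes \<open>t = 0\<close>, where the factor \<open>t ^ 3\<close>
    vanishes.\<close>
  have V1: "V p 2 (1 + t) = V p 2 1 + (p - 2) / 2 * t\<^sup>2 + r t * t ^ 3" for t
    by (simp add: r_def)
  have expand: "split_gain p m h = ((1 - m) * (p - 2) - m) * h\<^sup>2 + 2 * m / 9 * ((3 * h) powr p / p)
      + (1 - m) * ((2 * r h - 8 * r (- 2 * h)) / 3) * h ^ 3" if "h > 0" for h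
  proof -
    define X where "X = (3 * h) powr p / p"
    have A: "V p 2 (3 * h) = X - 9 * h\<^sup>2 / 2"
      using that by (simp add: V_def X_def power_mult_distrib)
    have B: "V p 2 (1 - 2 * h) = V p 2 1 + 2 * (p - 2) * h\<^sup>2 - 8 * r (- 2 * h) * h ^ 3"
      using V1[of "- 2 * h"] by (simp add: power_mult_distrib)
    show ?thesis
      unfolding split_gain_def A B V1[of h] X_def[symmetric] by (simp add: field_simps)
  qed
  from cond show ?thesis
  proof
    assume neg: "(1 - m) * (p - 2) < m"
    have "((\<lambda>h. (3 * h) powr p / p / h\<^sup>2) \<longlongrightarrow> 0) (at_right 0)" "((\<lambda>h :: real. h) \<longlongrightarrow> 0) (at_right 0)"
      using p by real_asymp+
    then have "((\<lambda>h. ((1 - m) * (p - 2) - m) + 2 * m / 9 * ((3 * h) powr p / p / h\<^sup>2)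
        + (1 - m) * ((2 * r h - 8 * r (- 2 * h)) / 3) * h)
      \<longlongrightarrow> ((1 - m) * (p - 2) - m) + 2 * m / 9 * 0
        + (1 - m) * ((2 * ((p - 1) * (p - 2) / 6) - 8 * ((p - 1) * (p - 2) / 6)) / 3) * 0) (at_right 0)"
      by (intro tendsto_intros r1 r2) auto
    then have "\<forall>\<^sub>F h in at_right 0. ((1 - m) * (p - 2) - m) + 2 * m / 9 * ((3 * h) powr p / p / h\<^sup>2)
        + (1 - m) * ((2 * r h - 8 * r (- 2 * h)) / 3) * h < 0"
      by (rule order_tendstoD) (use neg in simp)
    moreover have "\<forall>\<^sub>F h in at_right 0. (0::real) < h" by (rule eventually_at_right_less)
    ultimately show ?thesis
    proof eventually_elim
      case (elim h)
      have "split_gain p m h = (((1 - m) * (p - 2) - m) + 2 * m / 9 * ((3 * h) powr p / p / h\<^sup>2)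
        + (1 - m) * ((2 * r h - 8 * r (- 2 * h)) / 3) * h) * h\<^sup>2"
        unfolding expand[OF elim(2)] using elim(2)
        by (simp add: distrib_right power2_eq_square power3_eq_cube)
      with elim show ?case by (simp add: mult_neg_pos)
    qed
  next
    assume eq: "(1 - m) * (p - 2) = m \<and> p > 3"
    have "((\<lambda>h. (3 * h) powr p / p / h ^ 3) \<longlongrightarrow> 0) (at_right 0)"
      using eq by real_asymp
    then have "((\<lambda>h. 2 * m / 9 * ((3 * h) powr p / p / h ^ 3) + (1 - m) * ((2 * r h - 8 * r (- 2 * h)) / 3))
      \<longlongrightarrow> 2 * m / 9 * 0
        + (1 - m) * ((2 * ((p - 1) * (p - 2) / 6) - 8 * ((p - 1) * (p - 2) / 6)) / 3)) (at_right 0)"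
      by (intro tendsto_intros r1 r2) auto
    moreover have "2 * m / 9 * 0
        + (1 - m) * ((2 * ((p - 1) * (p - 2) / 6) - 8 * ((p - 1) * (p - 2) / 6)) / 3) < 0"
    proof -
      have "0 < (1 - m) * ((p - 1) * (p - 2))" using m p by simp
      then show ?thesis by simp
    qed
    ultimately have "\<forall>\<^sub>F h in at_right 0. 2 * m / 9 * ((3 * h) powr p / p / h ^ 3)
        + (1 - m) * ((2 * r h - 8 * r (- 2 * h)) / 3) < 0"
      by (rule order_tendstoD)
    moreover have "\<forall>\<^sub>F h in at_right 0. (0::real) < h" by (rule eventually_at_right_less)
    ultimately show ?thesis
    proof eventually_elim
      case (elim h)
      have "split_gain p m h = (2 * m / 9 * ((3 * h) powr p / p / h ^ 3)
        + (1 - m) * ((2 * r h - 8 * r (- 2 * h)) / 3)) * h ^ 3"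
        unfolding expand[OF elim(2)] using elim(2) eq
        by (simp add: distrib_right)
      with elim show ?case by (simp add: mult_neg_pos)
    qed
  qed
qed

lemma sum_split_weight: "sum (split_weight m) {0, 1, 2} = 1"
  and split_weight_nonneg: "0 < m \<Longrightarrow> m < 1 \<Longrightarrow> 0 \<le> split_weight m i"
  by (auto simp: split_weight_def)

text \<open>The two pieces of the divided atom share a position, so their masses add up to
  \<open>m\<close>. The second form divides the atom at 1, which serves the mirrored
  construction.\<close>

lemma rho_star_eq_atoms_split:
  assumes m: "0 < m" "m < 1"
  shows "rho_star m = atoms {0, 1, 2} (split_weight m) (\<lambda>i. if i = 2 then 1 else 0)" (is ?A)
    and "rho_star (1 - m) = atoms {0, 1, 2} (split_weight m) (\<lambda>i. if i = 2 then 0 else 1)" (is ?B)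
proof -
  have w: "ennreal (m / 3) + (ennreal (2 * m / 3) + c) = ennreal m + c" for c
    using m by (simp add: add.assoc[symmetric] flip: ennreal_plus)
  have *: "emeasure (atoms {0, 1, 2} (split_weight m) f) A
     = ennreal (m / 3) * indicator A (f 0) + (ennreal (2 * m / 3) * indicator A (f 1) + ennreal (1 - m) * indicator A (f 2))"
    if "A \<in> sets borel" for A f
    using that by (subst emeasure_atoms) (auto simp del: sum_mult_indicator simp: split_weight_def)
  show ?A
    by (rule emeasure_rho_star_eq, subst *) (auto simp: indicator_def w w[of 0, simplified])
  show ?B
    by (rule emeasure_rho_star_eq, subst *) (auto simp: indicator_def w w[of 0, simplified] add.commute)
qed

lemma energy_split_atoms:
  assumes m: "0 < m" "m < 1"
  shows "energy p q (atoms {0, 1, 2} (split_weight m) f)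
    = 2 * m\<^sup>2 / 9 * V p q (f 0 - f 1) + m * (1 - m) * ((V p q (f 0 - f 2) + 2 * V p q (f 1 - f 2)) / 3)"
proof -
  have "V p q (f i - f j) = V p q (f j - f i)" for i j
    using V_minus[of p q "f i - f j"] by simp
  note sym = this[of 1 0] this[of 2 0] this[of 2 1]
  show ?thesis
    by (subst energy_atoms)
      (use split_weight_nonneg[OF m] in \<open>auto simp: sym[unfolded One_nat_def] split_weight_def power2_eq_square field_simps\<close>)
qed

text \<open>Splitting lowers the energy, and widening the distance between the atoms raises it,
  because \<open>V\<close> is strictly convex near 1 with zero slope there. The parameters
  \<open>c\<close> and \<open>s\<close> place the divided atom at 0 or, after reflection, at
  1.\<close>

lemma saddle_point_split:
  assumes m: "0 < m" "m < 1" and p: "p > 2"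
    and cond: "(1 - m) * (p - 2) < m \<or> (1 - m) * (p - 2) = m \<and> p > 3"
    and s: "s \<in> {1, - 1 :: real}"
    and \<rho>: "\<rho> = atoms {0, 1, 2} (split_weight m) (\<lambda>i. c + s * (if i = 2 then 1 else 0))"
  shows "saddle_point p 2 \<rho>"
  unfolding saddle_point_def
proof (intro allI impI conjI)
  let ?\<mu> = "\<lambda>a0 a1 a2. atoms {0, 1, 2} (split_weight m) (\<lambda>i. c + s * (if i = 0 then a0 else if i = 1 then a1 else a2))"
  have P: "prob_meas (?\<mu> a0 a1 a2)" for a0 a1 a2
    by (intro prob_meas_atoms sum_split_weight split_weight_nonneg m) simp
  have E: "energy p 2 (?\<mu> a0 a1 a2) = 2 * m\<^sup>2 / 9 * V p 2 (a0 - a1) + m * (1 - m) * ((V p 2 (a2 - a0) + 2 * V p 2 (a2 - a1)) / 3)"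
    for a0 a1 a2
  proof -
    have "V p 2 (s * a - s * b) = V p 2 (a - b)" "V p 2 (s * a - s * b) = V p 2 (b - a)" for a b
      using s V_minus[of p 2 "a - b"] by auto
    then show ?thesis by (subst energy_split_atoms[OF m]) simp
  qed
  have \<rho>': "\<rho> = ?\<mu> 0 0 1" unfolding \<rho> atoms_def
    by (rule distr_cong) (auto simp: space_point_measure)
  have E\<rho>: "energy p 2 \<rho> = m * (1 - m) * V p 2 1"
    unfolding \<rho>' E by simp
  have d: "d_inf \<rho> (?\<mu> a0 a1 a2) \<le> ereal h"
    if "\<bar>a0\<bar> \<le> h" "\<bar>a1\<bar> \<le> h" "\<bar>a2 - 1\<bar> \<le> h" for a0 a1 a2 h
    unfolding \<rho>' by (intro d_inf_atoms_le sum_split_weight split_weight_nonneg m) (use that s in \<open>auto\<close>)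
  fix \<epsilon> :: real assume "\<epsilon> > 0"
  then have "\<forall>\<^sub>F h in at_right 0. h < \<epsilon> / 2" "\<forall>\<^sub>F h in at_right 0. (0::real) < h"
    by (auto simp: eventually_at_right_less intro!: eventually_at_right_field[THEN iffD2] exI[of _ "\<epsilon> / 2"])
  note small = this
  have "\<forall>\<^sub>F h in at_right 0. split_gain p m h < 0 \<and> h < \<epsilon> / 2 \<and> 0 < h"
    by (intro eventually_conj small eventually_split_gain_neg m p cond)
  from eventually_happens'[OF trivial_limit_at_right_real this]
  obtain h where h: "split_gain p m h < 0" "h < \<epsilon> / 2" "0 < h" by blast
  have "energy p 2 (?\<mu> (2 * h) (- h) 1) = energy p 2 \<rho> + m * split_gain p m h"
    unfolding E\<rho> E split_gain_def by (simp add: power2_eq_square field_simps)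
  also have "\<dots> < energy p 2 \<rho>" using h m by (simp add: mult_pos_neg)
  finally have "\<not> energy p 2 \<rho> \<le> energy p 2 (?\<mu> (2 * h) (- h) 1)" by simp
  moreover have "d_inf \<rho> (?\<mu> (2 * h) (- h) 1) < ereal \<epsilon>"
    by (rule le_less_trans[OF d[of _ "2 * h"]]) (use h in auto)
  ultimately show "\<not> (\<forall>\<mu>. prob_meas \<mu> \<and> d_inf \<rho> \<mu> < ereal \<epsilon> \<longrightarrow> energy p 2 \<rho> \<le> energy p 2 \<mu>)"
    using P by blast
  \<comment> \<open>The constant \<open>(p - 2) / 4\<close> is half of the quadratic Taylor
    coefficient at 1.\<close>
  obtain \<delta> where \<delta>: "\<delta> > 0" "\<And>t. \<bar>t\<bar> < \<delta> \<Longrightarrow> V p 2 1 + (p - 2) / 4 * t\<^sup>2 \<le> V p 2 (1 + t)"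
    by (rule V_lower_bound_at_1[of p 2 "(p - 2) / 4"]) (use p in auto)
  define t where "t = min \<delta> \<epsilon> / 2"
  have t: "0 < t" "t < \<delta>" "t < \<epsilon>" using \<delta>(1) \<open>\<epsilon> > 0\<close> by (auto simp: t_def min_def)
  have "V p 2 1 < V p 2 1 + (p - 2) / 4 * t\<^sup>2" using p t by simp
  also have "\<dots> \<le> V p 2 (1 + t)" using t by (intro \<delta>) auto
  finally have "energy p 2 \<rho> < energy p 2 (?\<mu> 0 0 (1 + t))"
    unfolding E\<rho> E using m by simp
  then have "\<not> energy p 2 (?\<mu> 0 0 (1 + t)) \<le> energy p 2 \<rho>" by simp
  moreover have "d_inf \<rho> (?\<mu> 0 0 (1 + t)) < ereal \<epsilon>"
    by (rule le_less_trans[OF d[of _ t]]) (use t in auto)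
  ultimately show "\<not> (\<forall>\<mu>. prob_meas \<mu> \<and> d_inf \<rho> \<mu> < ereal \<epsilon> \<longrightarrow> energy p 2 \<mu> \<le> energy p 2 \<rho>)"
    using P by blast
qed

lemma saddle_point_rho_star:
  assumes m: "0 < m" "m < 1" and p: "p > 2"
    and cond: "(1 - m) * (p - 2) < m \<or> (1 - m) * (p - 2) = m \<and> p > 3"
  shows "saddle_point p 2 (rho_star m)" "saddle_point p 2 (rho_star (1 - m))"
proof -
  show "saddle_point p 2 (rho_star m)"
    by (rule saddle_point_split[OF m p cond, of 1 _ 0]) (simp_all add: rho_star_eq_atoms_split(1)[OF m])
  show "saddle_point p 2 (rho_star (1 - m))"
    by (rule saddle_point_split[OF m p cond, of "-1" _ 1], simp, subst rho_star_eq_atoms_split(2)[OF m])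
      (rule arg_cong[where f = "atoms _ _"], auto)
qed

section \<open>Assembling the six parameter ranges\<close>

theorem theorem2:
  fixes p q :: real
  assumes "p > q" and "q \<ge> 2"
  shows "(q > 2 \<longrightarrow> (\<forall>m. 0 < m \<and> m < 1 \<longrightarrow> strict_local_min p q (rho_star m)))
    \<and> (p > 3 \<and> q = 2 \<longrightarrow> (\<forall>m. 1/(p-1) < m \<and> m < (p-2)/(p-1) \<longrightarrow> strict_local_min p q (rho_star m)))
    \<and> (p > 3 \<and> q = 2 \<longrightarrow> (\<forall>m. (0 < m \<and> m \<le> 1/(p-1)) \<or> ((p-2)/(p-1) \<le> m \<and> m < 1) \<longrightarrow> saddle_point p q (rho_star m)))
    \<and> (p < 3 \<and> q = 2 \<longrightarrow> (\<forall>m. 0 < m \<and> m < 1 \<longrightarrow> saddle_point p q (rho_star m)))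
    \<and> (p = 3 \<and> q = 2 \<longrightarrow> (\<forall>m. ((0 < m \<and> m < 1/2) \<or> (1/2 < m \<and> m < 1)) \<longrightarrow> saddle_point p q (rho_star m)))
    \<and> (p = 3 \<and> q = 2 \<longrightarrow> strict_local_min p q (rho_star (1/2)))"
proof (intro conjI impI allI)
  fix m :: real assume "q > 2" and "0 < m \<and> m < 1"
  then have m: "0 < m" "m < 1" by auto
  \<comment> \<open>Here \<open>a\<close> is half of the quadratic Taylor coefficient at 1. As
    \<open>b\<close> may be arbitrarily small for \<open>q > 2\<close>, it is taken below both
    \<open>m * a\<close> and \<open>(1 - m) * a\<close>.\<close>
  define a where "a = (p - q) / 4"
  define b where "b = min m (1 - m) * a / 2"
  have a: "0 < a" "a < (p - q) / 2" using assms by (auto simp: a_def)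
  have b: "b > 0" using a m by (simp add: b_def)
  obtain \<delta> where \<delta>: "\<delta> > 0" "\<And>t. \<bar>t\<bar> < \<delta> \<Longrightarrow> V p q 1 + a * t\<^sup>2 \<le> V p q (1 + t)"
    by (rule V_lower_bound_at_1[of p q a]) (use a assms in auto)
  obtain \<delta>' where \<delta>': "\<delta>' > 0" "\<And>t. \<bar>t\<bar> < \<delta>' \<Longrightarrow> - b * t\<^sup>2 \<le> V p q t"
    by (rule V_lower_bound_at_0[of p q b]) (use b \<open>q > 2\<close> assms in auto)
  define \<epsilon> where "\<epsilon> = min (1/2) (min \<delta> \<delta>' / 3)"
  have \<epsilon>: "0 < \<epsilon>" "\<epsilon> \<le> 1/2" "2 * \<epsilon> < \<delta>" "2 * \<epsilon> < \<delta>'"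
    using \<delta>(1) \<delta>'(1) by (auto simp: \<epsilon>_def min_def)
  have bm: "b < (1 - m) * a" "b < m * a"
  proof -
    have "min m (1 - m) * a \<le> (1 - m) * a" "min m (1 - m) * a \<le> m * a"
      using a by (auto intro: mult_right_mono)
    then show "b < (1 - m) * a" "b < m * a" using b unfolding b_def by linarith+
  qed
  have "m * b \<le> b" "(1 - m) * b \<le> b" using m b by (auto simp: mult_left_le_one_le)
  then show "strict_local_min p q (rho_star m)"
    using \<epsilon> bm a assms m
    by (intro strict_local_min_quadratic[of m p q \<epsilon> a b] \<delta>(2) \<delta>'(2)) auto
next
  fix m :: real assume pq: "p > 3 \<and> q = 2" and "1/(p-1) < m \<and> m < (p-2)/(p-1)"
  then have m': "1 < m * (p - 1)" "m * (p - 1) < p - 2" by (auto simp: field_simps)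
  have "0 < m * (p - 1)" "0 < (1 - m) * (p - 1)" using m' by (simp_all add: algebra_simps)
  then have m: "0 < m" "m < 1" using pq by (auto simp: zero_less_mult_iff)
  \<comment> \<open>With \<open>b = 1/2\<close> the quadratic criterion demands that
    \<open>2 * a\<close> exceed both mass ratios. The range of \<open>m\<close> puts their maximum
    \<open>s\<close> below \<open>p - 2\<close>, and \<open>a\<close> is the midpoint of
    \<open>s / 2\<close> and \<open>(p - 2) / 2\<close>.\<close>
  define s where "s = max (m / (1 - m)) ((1 - m) / m)"
  have s: "m / (1 - m) < p - 2" "(1 - m) / m < p - 2" using m m' by (simp_all add: field_simps)
  then have "s < p - 2" "s > 0" using m by (auto simp: s_def max_def)
  define a where "a = (p - 2 + s) / 4"
  have a: "a < (p - 2) / 2" "s / 2 < a" "a > 0" using \<open>s < p - 2\<close> \<open>s > 0\<close> by (auto simp: a_def)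
  have "m / (1 - m) \<le> s" "(1 - m) / m \<le> s" by (simp_all add: s_def)
  moreover have "s < 2 * a" using a(2) by simp
  ultimately have "m / (1 - m) < 2 * a" "(1 - m) / m < 2 * a" by (blast intro: le_less_trans)+
  then have ab: "m * (1/2) < (1 - m) * a" "(1 - m) * (1/2) < m * a" using m by (auto simp: field_simps)
  obtain \<delta> where \<delta>: "\<delta> > 0" "\<And>t. \<bar>t\<bar> < \<delta> \<Longrightarrow> V p 2 1 + a * t\<^sup>2 \<le> V p 2 (1 + t)"
    by (rule V_lower_bound_at_1[of p 2 a]) (use a pq in auto)
  define \<epsilon> where "\<epsilon> = min (1/2) (\<delta> / 3)"
  have \<epsilon>: "0 < \<epsilon>" "\<epsilon> \<le> 1/2" "2 * \<epsilon> < \<delta>" using \<delta>(1) by (auto simp: \<epsilon>_def min_def)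
  have "strict_local_min p 2 (rho_star m)"
    using \<epsilon> a ab pq m
    by (intro strict_local_min_quadratic[of m p 2 \<epsilon> a "1/2"] \<delta>(2) V_2_lower_bound) auto
  with pq show "strict_local_min p q (rho_star m)" by simp
next
  fix m :: real assume pq: "p > 3 \<and> q = 2" and "(0 < m \<and> m \<le> 1/(p-1)) \<or> ((p-2)/(p-1) \<le> m \<and> m < 1)"
  then consider "0 < m" "m * (p - 1) \<le> 1" | "p - 2 \<le> m * (p - 1)" "m < 1"
    by (auto simp: field_simps)
  then have "saddle_point p 2 (rho_star m)"
  proof cases
    case 1
    have "0 < (1 - m) * (p - 1)" using 1 pq by (simp add: algebra_simps)
    then have "m < 1" using pq by (simp add: zero_less_mult_iff)
    \<comment> \<open>Here the heavy atom is the one at 1, so it is the one that gets split, with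
      \<open>1 - m\<close> in the role of the divided mass.\<close>
    moreover have "m * (p - 2) \<le> 1 - m" using 1 by (simp add: algebra_simps)
    ultimately show ?thesis
      using saddle_point_rho_star(2)[of "1 - m" p] 1 pq by (auto simp: le_less)
  next
    case 2
    have "0 < m * (p - 1)" using 2 pq by linarith
    then have "0 < m" using pq by (simp add: zero_less_mult_iff)
    moreover have "(1 - m) * (p - 2) \<le> m" using 2 by (simp add: algebra_simps)
    ultimately show ?thesis
      using saddle_point_rho_star(1)[of m p] 2 pq by (auto simp: le_less)
  qed
  with pq show "saddle_point p q (rho_star m)" by simp
next
  fix m :: real assume pq: "p < 3 \<and> q = 2" and m: "0 < m \<and> m < 1"
  \<comment> \<open>If both alternatives failed, then 1 \<le> \<open>p - 2\<close>, contrary to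
    \<open>p < 3\<close>. So at least one of the two atoms is heavy enough to be split.\<close>
  have "m * (p - 1) < 1 \<or> p - 2 < m * (p - 1)" using pq by linarith
  then have "saddle_point p 2 (rho_star m)"
    using saddle_point_rho_star(1)[of m p] saddle_point_rho_star(2)[of "1 - m" p] m pq assms
    by (auto simp: algebra_simps)
  with pq show "saddle_point p q (rho_star m)" by simp
next
  fix m :: real assume pq: "p = 3 \<and> q = 2" and m: "(0 < m \<and> m < 1/2) \<or> (1/2 < m \<and> m < 1)"
  \<comment> \<open>The critical mass is 1/2, so the heavier atom is split and the strict
    second-order condition applies.\<close>
  then have "saddle_point 3 2 (rho_star m)"
    using saddle_point_rho_star(1)[of m 3] saddle_point_rho_star(2)[of "1 - m" 3]
    by (auto simp: algebra_simps)
  with pq show "saddle_point p q (rho_star m)" by simp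
next
  assume "p = 3 \<and> q = 2"
  then show "strict_local_min p q (rho_star (1/2))" using strict_local_min_cubic by simp
qed

end
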